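(* Let $K$ be a field, let $\alpha\in K$ with $\alpha\neq0$, and let $L_9$ be the three-dimensional Leibniz algebra over $K$ with basis $\{e_1,e_2,e_3\}$ and nonzero products of basis elements $e_1e_3=e_2$, $e_2e_3=\alpha e_1$. Let $\mathcal B_{L_9}\subset\mathcal L\langle X\rangle$ be the set consisting of the monomials \[ x_{j_1}^{(m_1)}x_{j_2}^{(m_2)}\cdots x_{j_n}^{(m_n)}\qquad (n\ge 1,\ m_i\ge 1,\ j_2<j_3<\dots<j_n,\ j_1\ne j_k\text{ for all }k\ge2). \] If $K$ is infinite, then the images of $\mathcal B_{L_9}$ in the relatively free algebra $\mathcal L\langle X\rangle/T(L_9)$ form a basis of this algebra. If $K$ is finite with $|K|=q$ odd, then the images of those monomials of $\mathcal B_{L_9}$ with $1\le m_1\le q$ and $1\le m_i<q$ for all $i\ge2$ form a basis of $\mathcal L\langle X\rangle/T(L_9)$. If $K$ is finite with $|K|=q$ even, then the images of those monomials of $\mathcal B_{L_9}$ with \[ 1\le m_1<2q,\qquad 1\le m_2<2q-1,\qquad 1\le m_i<q\ \text{ for all } i>2, \] and moreover $m_2<q$ whenever $m_1>1$, form a basis of $\mathcal L\langle X\rangle/T(L_9)$. In all cases, the codimension sequence of $L_9$ is $c_n(L_9)=n$ for all $n\geq 1$, and the exponent of $L_9$ is equal to $1$.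
   Context: A (right) Leibniz algebra over $K$ is a $K$-algebra satisfying $x(yz)=(xy)z-(xz)y$. $\mathcal L\langle X\rangle$ is the free Leibniz algebra over $K$ on $X=\{x_1,x_2,\dots\}$; $T(L)$ is the ideal of polynomials vanishing under all substitutions of elements of $L$. Products without brackets are left-normed, and $x^{(m)}$ means $m$ consecutive occurrences of $x$ in a left-normed product; thus $x_{j_1}^{(m_1)}x_{j_2}^{(m_2)}\cdots$ is the left-normed product of $m_1$ copies of $x_{j_1}$, then $m_2$ copies of $x_{j_2}$, etc. $P_n\subset\mathcal L\langle X\rangle$ is the space of multilinear polynomials in $x_1,\dots,x_n$ (each variable appears exactly once in each monomial), $c_n(L)=\dim_K P_n/(P_n\cap T(L))$ is the $n$-th codimension, and the exponent of $L$ is $\exp(L)=\lim_{n\to\infty}\sqrt[n]{c_n(L)}$. Products of basis elements not listed are zero. *)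

theory Defs
  imports
    Complex_Main
    "HOL-Library.Poly_Mapping"
    "HOL-Library.Cardinality"
    "HOL-Algebra.QuotRing"
    "Jordan_Normal_Form.VS_Connect"
begin

section \<open>Algebras over a field\<close>

text \<open>
  Algebras over the field \<open>'k\<close> (not associative and not unital in general) are records of type
  \<^typ>\<open>('k, 'a) module\<close>; their component \<^const>\<open>one\<close> carries no meaning.
\<close>

locale nonassoc_algebra = vectorspace "class_ring :: 'k::field ring" A
  for A :: "('k::field, 'a) module" (structure) +
  assumes mult_closed: "x \<in> carrier A \<Longrightarrow> y \<in> carrier A \<Longrightarrow> x \<otimes>\<^bsub>A\<^esub> y \<in> carrier A"
    and mult_add_left: "x \<in> carrier A \<Longrightarrow> y \<in> carrier A \<Longrightarrow> z \<in> carrier A \<Longrightarrow>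
      (x \<oplus>\<^bsub>A\<^esub> y) \<otimes>\<^bsub>A\<^esub> z = x \<otimes>\<^bsub>A\<^esub> z \<oplus>\<^bsub>A\<^esub> y \<otimes>\<^bsub>A\<^esub> z"
    and mult_add_right: "x \<in> carrier A \<Longrightarrow> y \<in> carrier A \<Longrightarrow> z \<in> carrier A \<Longrightarrow>
      z \<otimes>\<^bsub>A\<^esub> (x \<oplus>\<^bsub>A\<^esub> y) = z \<otimes>\<^bsub>A\<^esub> x \<oplus>\<^bsub>A\<^esub> z \<otimes>\<^bsub>A\<^esub> y"
    and mult_smult_left: "x \<in> carrier A \<Longrightarrow> y \<in> carrier A \<Longrightarrow>
      (c \<odot>\<^bsub>A\<^esub> x) \<otimes>\<^bsub>A\<^esub> y = c \<odot>\<^bsub>A\<^esub> (x \<otimes>\<^bsub>A\<^esub> y)"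
    and mult_smult_right: "x \<in> carrier A \<Longrightarrow> y \<in> carrier A \<Longrightarrow>
      x \<otimes>\<^bsub>A\<^esub> (c \<odot>\<^bsub>A\<^esub> y) = c \<odot>\<^bsub>A\<^esub> (x \<otimes>\<^bsub>A\<^esub> y)"

locale leibniz_algebra = nonassoc_algebra A for A :: "('k::field, 'a) module" (structure) +
  assumes leibniz: "x \<in> carrier A \<Longrightarrow> y \<in> carrier A \<Longrightarrow> z \<in> carrier A \<Longrightarrow>
      x \<otimes>\<^bsub>A\<^esub> (y \<otimes>\<^bsub>A\<^esub> z) = (x \<otimes>\<^bsub>A\<^esub> y) \<otimes>\<^bsub>A\<^esub> z \<ominus>\<^bsub>A\<^esub> (x \<otimes>\<^bsub>A\<^esub> z) \<otimes>\<^bsub>A\<^esub> y"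

definition algebra_ideal :: "('k::field, 'a) module \<Rightarrow> 'a set \<Rightarrow> bool" where
  "algebra_ideal A I \<longleftrightarrow> VectorSpace.subspace class_ring I A \<and>
     (\<forall>x\<in>I. \<forall>y\<in>carrier A. x \<otimes>\<^bsub>A\<^esub> y \<in> I \<and> y \<otimes>\<^bsub>A\<^esub> x \<in> I)"

text \<open>The quotient by a subspace or ideal, extending \<^const>\<open>FactRing\<close> by the scalar action on cosets.\<close>

definition quotient_algebra :: "('k, 'a) module \<Rightarrow> 'a set \<Rightarrow> ('k, 'a set) module" where
  "quotient_algebra A I =
    \<lparr>carrier = a_rcosets\<^bsub>A\<^esub> I, mult = rcoset_mult A I, one = I +>\<^bsub>A\<^esub> \<one>\<^bsub>A\<^esub>,
     zero = I, add = set_add A, smult = (\<lambda>c X. \<Union>x\<in>X. I +>\<^bsub>A\<^esub> (c \<odot>\<^bsub>A\<^esub> x))\<rparr>"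

lemma coset_quotient:
  assumes "vectorspace (class_ring :: 'k::field ring) A" and "VectorSpace.subspace class_ring W A"
  shows "vectorspace class_ring (quotient_algebra A W)"
    and "\<And>x. x \<in> carrier A \<Longrightarrow> W +>\<^bsub>A\<^esub> x \<in> carrier (quotient_algebra A W)"
    and "\<And>x y. x \<in> carrier A \<Longrightarrow> y \<in> carrier A \<Longrightarrow>
      (W +>\<^bsub>A\<^esub> x) \<oplus>\<^bsub>quotient_algebra A W\<^esub> (W +>\<^bsub>A\<^esub> y) = W +>\<^bsub>A\<^esub> (x \<oplus>\<^bsub>A\<^esub> y)"
    and "\<And>c x. x \<in> carrier A \<Longrightarrow>
      c \<odot>\<^bsub>quotient_algebra A W\<^esub> (W +>\<^bsub>A\<^esub> x) = W +>\<^bsub>A\<^esub> (c \<odot>\<^bsub>A\<^esub> x)"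
    and "\<And>x y. x \<in> carrier A \<Longrightarrow> y \<in> carrier A \<Longrightarrow>
       (W +>\<^bsub>A\<^esub> x = W +>\<^bsub>A\<^esub> y) = (x \<ominus>\<^bsub>A\<^esub> y \<in> W)"
    and "\<And>X. X \<in> carrier (quotient_algebra A W) \<Longrightarrow> \<exists>x\<in>carrier A. X = W +>\<^bsub>A\<^esub> x"
proof -
  interpret vectorspace class_ring A by fact
  interpret W: VectorSpace.subspace class_ring W A by fact
  interpret W: LinearCombinations.submodule class_ring W A by (rule W.submod)
  have "subgroup W (add_monoid A)"
  proof
    fix x assume x: "x \<in> W"
    then have "(- 1) \<odot>\<^bsub>A\<^esub> x = \<ominus>\<^bsub>A\<^esub> x"
      using W.subset smult_minus_1[of x] by (auto simp: class_ring_simps)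
    then have "\<ominus>\<^bsub>A\<^esub> x \<in> W"
      using x W.smult_closed[of "-1" x] by simp
    then show "inv\<^bsub>add_monoid A\<^esub> x \<in> W"
      by (simp add: a_inv_def)
  qed (use W.subset in auto)
  then interpret abelian_subgroup W A
    by (intro abelian_subgroupI3 additive_subgroup.intro abelian_group_axioms)
  have car: "carrier (quotient_algebra A W) = {W +>\<^bsub>A\<^esub> x |x. x \<in> carrier A}"
    by (auto simp: quotient_algebra_def A_RCOSETS_def')
  show cl: "\<And>x. x \<in> carrier A \<Longrightarrow> W +>\<^bsub>A\<^esub> x \<in> carrier (quotient_algebra A W)"
    and ex: "\<And>X. X \<in> carrier (quotient_algebra A W) \<Longrightarrow> \<exists>x\<in>carrier A. X = W +>\<^bsub>A\<^esub> x"
    unfolding car by blast+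
  show ad: "\<And>x y. x \<in> carrier A \<Longrightarrow> y \<in> carrier A \<Longrightarrow>
      (W +>\<^bsub>A\<^esub> x) \<oplus>\<^bsub>quotient_algebra A W\<^esub> (W +>\<^bsub>A\<^esub> y) = W +>\<^bsub>A\<^esub> (x \<oplus>\<^bsub>A\<^esub> y)"
    by (simp add: quotient_algebra_def a_rcos_sum)
  have mem: "y \<in> W +>\<^bsub>A\<^esub> x \<longleftrightarrow> y \<in> carrier A \<and> y \<ominus>\<^bsub>A\<^esub> x \<in> W" if "x \<in> carrier A" for x y
    unfolding a_minus_def using a_rcos_module[OF that] a_elemrcos_carrier[OF that] by blast
  show eq: "\<And>x y. x \<in> carrier A \<Longrightarrow> y \<in> carrier A \<Longrightarrow>
       (W +>\<^bsub>A\<^esub> x = W +>\<^bsub>A\<^esub> y) = (x \<ominus>\<^bsub>A\<^esub> y \<in> W)"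
    by (metis a_repr_independence' a_rcos_self mem)
  have smul: "c \<odot>\<^bsub>A\<^esub> y \<ominus>\<^bsub>A\<^esub> c \<odot>\<^bsub>A\<^esub> x = c \<odot>\<^bsub>A\<^esub> (y \<ominus>\<^bsub>A\<^esub> x)"
    if "x \<in> carrier A" "y \<in> carrier A" for c x y
    using that by (simp add: a_minus_def smult_r_distr smult_r_minus)
  show sm: "\<And>c x. x \<in> carrier A \<Longrightarrow>
      c \<odot>\<^bsub>quotient_algebra A W\<^esub> (W +>\<^bsub>A\<^esub> x) = W +>\<^bsub>A\<^esub> (c \<odot>\<^bsub>A\<^esub> x)"
  proof -
    fix c x assume x: "x \<in> carrier A"
    have "W +>\<^bsub>A\<^esub> (c \<odot>\<^bsub>A\<^esub> y) = W +>\<^bsub>A\<^esub> (c \<odot>\<^bsub>A\<^esub> x)" if "y \<in> W +>\<^bsub>A\<^esub> x" for y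
    proof -
      have y: "y \<in> carrier A" "y \<ominus>\<^bsub>A\<^esub> x \<in> W" using that mem[OF x] by blast+
      then have "c \<odot>\<^bsub>A\<^esub> y \<ominus>\<^bsub>A\<^esub> c \<odot>\<^bsub>A\<^esub> x \<in> W"
        unfolding smul[OF x y(1)] by (intro W.smult_closed) auto
      then show ?thesis using x y by (subst eq) auto
    qed
    then have "(\<Union>y\<in>W +>\<^bsub>A\<^esub> x. W +>\<^bsub>A\<^esub> (c \<odot>\<^bsub>A\<^esub> y)) = W +>\<^bsub>A\<^esub> (c \<odot>\<^bsub>A\<^esub> x)"
      using a_rcos_self[OF x] by blast
    then show "c \<odot>\<^bsub>quotient_algebra A W\<^esub> (W +>\<^bsub>A\<^esub> x) = W +>\<^bsub>A\<^esub> (c \<odot>\<^bsub>A\<^esub> x)"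
      by (simp add: quotient_algebra_def)
  qed
  have ze: "\<zero>\<^bsub>quotient_algebra A W\<^esub> = W +>\<^bsub>A\<^esub> \<zero>\<^bsub>A\<^esub>"
    using a_coset_add_zero[OF a_subset] by (simp add: quotient_algebra_def)
  let ?Q = "quotient_algebra A W"
  have "abelian_group ?Q"
  proof (rule abelian_groupI)
    fix X assume X: "X \<in> carrier ?Q"
    then obtain x where x: "x \<in> carrier A" "X = W +>\<^bsub>A\<^esub> x" using ex by blast
    show "\<exists>Y\<in>carrier ?Q. Y \<oplus>\<^bsub>?Q\<^esub> X = \<zero>\<^bsub>?Q\<^esub>"
    proof
      show "(W +>\<^bsub>A\<^esub> (\<ominus>\<^bsub>A\<^esub> x)) \<oplus>\<^bsub>?Q\<^esub> X = \<zero>\<^bsub>?Q\<^esub>"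
        using x by (simp only: ze ad M.a_inv_closed M.l_neg)
      show "W +>\<^bsub>A\<^esub> (\<ominus>\<^bsub>A\<^esub> x) \<in> carrier ?Q"
        using x by (simp only: cl M.a_inv_closed)
    qed
    show "\<zero>\<^bsub>?Q\<^esub> \<oplus>\<^bsub>?Q\<^esub> X = X"
      using x by (simp only: ze ad M.zero_closed M.l_zero)
    fix Y assume "Y \<in> carrier ?Q"
    then obtain y where y: "y \<in> carrier A" "Y = W +>\<^bsub>A\<^esub> y" using ex by blast
    show "X \<oplus>\<^bsub>?Q\<^esub> Y \<in> carrier ?Q"
      using x y by (simp only: ad cl M.a_closed)
    show "X \<oplus>\<^bsub>?Q\<^esub> Y = Y \<oplus>\<^bsub>?Q\<^esub> X"
      using x y by (simp only: ad M.a_comm[of x y])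
    fix Z assume "Z \<in> carrier ?Q"
    then obtain z where z: "z \<in> carrier A" "Z = W +>\<^bsub>A\<^esub> z" using ex by blast
    show "X \<oplus>\<^bsub>?Q\<^esub> Y \<oplus>\<^bsub>?Q\<^esub> Z = X \<oplus>\<^bsub>?Q\<^esub> (Y \<oplus>\<^bsub>?Q\<^esub> Z)"
      using x y z by (simp only: ad M.a_closed M.a_assoc)
  qed (simp only: ze cl M.zero_closed)
  then have "Module.module class_ring ?Q"
  proof (intro moduleI class_cring.is_cring)
    fix X a assume X: "X \<in> carrier ?Q"
    then obtain x where x: "x \<in> carrier A" "X = W +>\<^bsub>A\<^esub> x" using ex by blast
    show "a \<odot>\<^bsub>?Q\<^esub> X \<in> carrier ?Q"
      using x by (simp only: sm cl) (intro cl, simp)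
    show "\<one>\<^bsub>class_ring\<^esub> \<odot>\<^bsub>?Q\<^esub> X = X"
      using x by (simp only: sm smult_one)
    fix b
    show "(a \<oplus>\<^bsub>class_ring\<^esub> b) \<odot>\<^bsub>?Q\<^esub> X = a \<odot>\<^bsub>?Q\<^esub> X \<oplus>\<^bsub>?Q\<^esub> b \<odot>\<^bsub>?Q\<^esub> X"
      using x smult_l_distr[of a b x] by (simp add: sm ad)
    show "(a \<otimes>\<^bsub>class_ring\<^esub> b) \<odot>\<^bsub>?Q\<^esub> X = a \<odot>\<^bsub>?Q\<^esub> (b \<odot>\<^bsub>?Q\<^esub> X)"
      using x smult_assoc1[of a b x] by (simp add: sm)
    fix Y assume "Y \<in> carrier ?Q"
    then obtain y where y: "y \<in> carrier A" "Y = W +>\<^bsub>A\<^esub> y" using ex by blast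
    show "a \<odot>\<^bsub>?Q\<^esub> (X \<oplus>\<^bsub>?Q\<^esub> Y) = a \<odot>\<^bsub>?Q\<^esub> X \<oplus>\<^bsub>?Q\<^esub> a \<odot>\<^bsub>?Q\<^esub> Y"
      using x y smult_r_distr[of a x y] by (simp add: sm ad)
  qed
  moreover have "field (class_ring :: 'k ring)" ..
  ultimately show "vectorspace class_ring ?Q"
    by (rule vectorspace.intro)
qed

lemma (in abelian_group) minus_add_minus:
  assumes "x \<in> carrier G" "y \<in> carrier G" "z \<in> carrier G"
  shows "(x \<ominus> y) \<oplus> (y \<ominus> z) = x \<ominus> z"
  using assms by (simp add: a_minus_def a_assoc r_neg1)

lemma (in nonassoc_algebra) minus_eq_smult:
  assumes "y \<in> carrier A"
  shows "x \<ominus>\<^bsub>A\<^esub> y = x \<oplus>\<^bsub>A\<^esub> (- 1) \<odot>\<^bsub>A\<^esub> y"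
  using smult_minus_1[OF assms] by (simp add: a_minus_def class_ring_simps)

lemma (in nonassoc_algebra) mult_minus_left:
  "x \<in> carrier A \<Longrightarrow> y \<in> carrier A \<Longrightarrow> z \<in> carrier A \<Longrightarrow>
    (x \<ominus>\<^bsub>A\<^esub> y) \<otimes>\<^bsub>A\<^esub> z = x \<otimes>\<^bsub>A\<^esub> z \<ominus>\<^bsub>A\<^esub> y \<otimes>\<^bsub>A\<^esub> z"
  using smult_closed[of "- 1" y] by (simp add: minus_eq_smult mult_add_left mult_smult_left mult_closed)

lemma (in nonassoc_algebra) mult_minus_right:
  "x \<in> carrier A \<Longrightarrow> y \<in> carrier A \<Longrightarrow> z \<in> carrier A \<Longrightarrow>
    z \<otimes>\<^bsub>A\<^esub> (x \<ominus>\<^bsub>A\<^esub> y) = z \<otimes>\<^bsub>A\<^esub> x \<ominus>\<^bsub>A\<^esub> z \<otimes>\<^bsub>A\<^esub> y"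
  using smult_closed[of "- 1" y] by (simp add: minus_eq_smult mult_add_right mult_smult_right mult_closed)

lemma (in nonassoc_algebra) quotient_mult:
  assumes "algebra_ideal A I" "x \<in> carrier A" "y \<in> carrier A"
  shows "(I +>\<^bsub>A\<^esub> x) \<otimes>\<^bsub>quotient_algebra A I\<^esub> (I +>\<^bsub>A\<^esub> y) = I +>\<^bsub>A\<^esub> (x \<otimes>\<^bsub>A\<^esub> y)"
proof -
  interpret I: VectorSpace.subspace class_ring I A
    using assms(1) unfolding algebra_ideal_def by blast
  interpret I: LinearCombinations.submodule class_ring I A by (rule I.submod)
  note q = coset_quotient[OF vectorspace_axioms I.subspace_axioms]
  have mem: "v \<in> carrier A \<and> v \<ominus>\<^bsub>A\<^esub> u \<in> I" if v: "v \<in> I +>\<^bsub>A\<^esub> u" and u: "u \<in> carrier A" for u v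
  proof -
    from v obtain h where h: "h \<in> I" "v = h \<oplus>\<^bsub>A\<^esub> u" unfolding a_r_coset_def' by blast
    with u I.subset have "h \<in> carrier A" by auto
    with h u show ?thesis by (simp only: a_minus_def M.a_assoc M.r_neg M.a_inv_closed M.r_zero M.a_closed)
  qed
  have self: "u \<in> I +>\<^bsub>A\<^esub> u" if "u \<in> carrier A" for u
    unfolding a_r_coset_def'
    by (rule UN_I[OF I.zero_closed]) (simp only: M.l_zero[OF that] singletonI)
  have "I +>\<^bsub>A\<^esub> (u \<otimes>\<^bsub>A\<^esub> v) = I +>\<^bsub>A\<^esub> (x \<otimes>\<^bsub>A\<^esub> y)" if "u \<in> I +>\<^bsub>A\<^esub> x" "v \<in> I +>\<^bsub>A\<^esub> y" for u v
  proof -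
    have u: "u \<in> carrier A" "u \<ominus>\<^bsub>A\<^esub> x \<in> I" and v: "v \<in> carrier A" "v \<ominus>\<^bsub>A\<^esub> y \<in> I"
      using mem[OF that(1) assms(2)] mem[OF that(2) assms(3)] by blast+
    have "(u \<ominus>\<^bsub>A\<^esub> x) \<otimes>\<^bsub>A\<^esub> v \<oplus>\<^bsub>A\<^esub> x \<otimes>\<^bsub>A\<^esub> (v \<ominus>\<^bsub>A\<^esub> y) \<in> I"
      using assms u v unfolding algebra_ideal_def by (intro I.m_closed) blast+
    also have "(u \<ominus>\<^bsub>A\<^esub> x) \<otimes>\<^bsub>A\<^esub> v \<oplus>\<^bsub>A\<^esub> x \<otimes>\<^bsub>A\<^esub> (v \<ominus>\<^bsub>A\<^esub> y) = u \<otimes>\<^bsub>A\<^esub> v \<ominus>\<^bsub>A\<^esub> x \<otimes>\<^bsub>A\<^esub> y"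
      using assms u v
      by (simp only: mult_minus_left mult_minus_right mult_closed M.minus_add_minus)
    finally show ?thesis
      using assms u v q(5)[of "u \<otimes>\<^bsub>A\<^esub> v" "x \<otimes>\<^bsub>A\<^esub> y"] mult_closed by blast
  qed
  then have "(\<Union>u\<in>I +>\<^bsub>A\<^esub> x. \<Union>v\<in>I +>\<^bsub>A\<^esub> y. I +>\<^bsub>A\<^esub> (u \<otimes>\<^bsub>A\<^esub> v)) = I +>\<^bsub>A\<^esub> (x \<otimes>\<^bsub>A\<^esub> y)"
    using self[OF assms(2)] self[OF assms(3)] by blast
  then show ?thesis
    by (simp add: quotient_algebra_def rcoset_mult_def)
qed

lemma (in nonassoc_algebra) quotient_nonassoc_algebra:
  assumes "algebra_ideal A I"
  shows "nonassoc_algebra (quotient_algebra A I)"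
proof -
  have "VectorSpace.subspace class_ring I A"
    using assms by (simp add: algebra_ideal_def)
  note q = coset_quotient[OF vectorspace_axioms this]
  show ?thesis
  proof (intro nonassoc_algebra.intro q(1) nonassoc_algebra_axioms.intro)
    let ?Q = "quotient_algebra A I"
    note m = quotient_mult[OF assms]
    fix X Y c assume "X \<in> carrier ?Q" "Y \<in> carrier ?Q"
    then obtain x y where x: "x \<in> carrier A" "X = I +>\<^bsub>A\<^esub> x" and y: "y \<in> carrier A" "Y = I +>\<^bsub>A\<^esub> y"
      by (meson q(6))
    have c: "c \<odot>\<^bsub>A\<^esub> u \<in> carrier A" if "u \<in> carrier A" for u
      using that by simp
    show "X \<otimes>\<^bsub>?Q\<^esub> Y \<in> carrier ?Q"
      using x y by (simp only: m q(2) mult_closed)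
    show "(c \<odot>\<^bsub>?Q\<^esub> X) \<otimes>\<^bsub>?Q\<^esub> Y = c \<odot>\<^bsub>?Q\<^esub> (X \<otimes>\<^bsub>?Q\<^esub> Y)"
      using x y by (simp only: m q(4) c mult_closed mult_smult_left)
    show "X \<otimes>\<^bsub>?Q\<^esub> (c \<odot>\<^bsub>?Q\<^esub> Y) = c \<odot>\<^bsub>?Q\<^esub> (X \<otimes>\<^bsub>?Q\<^esub> Y)"
      using x y by (simp only: m q(4) c mult_closed mult_smult_right)
    fix Z assume "Z \<in> carrier ?Q"
    then obtain z where z: "z \<in> carrier A" "Z = I +>\<^bsub>A\<^esub> z"
      by (meson q(6))
    show "(X \<oplus>\<^bsub>?Q\<^esub> Y) \<otimes>\<^bsub>?Q\<^esub> Z = X \<otimes>\<^bsub>?Q\<^esub> Z \<oplus>\<^bsub>?Q\<^esub> Y \<otimes>\<^bsub>?Q\<^esub> Z"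
      using x y z by (simp only: m q(3) M.a_closed mult_closed mult_add_left)
    show "Z \<otimes>\<^bsub>?Q\<^esub> (X \<oplus>\<^bsub>?Q\<^esub> Y) = Z \<otimes>\<^bsub>?Q\<^esub> X \<oplus>\<^bsub>?Q\<^esub> Z \<otimes>\<^bsub>?Q\<^esub> Y"
      using x y z by (simp only: m q(3) M.a_closed mult_closed mult_add_right)
  qed
qed

fun left_normed :: "('k, 'a) module \<Rightarrow> 'a list \<Rightarrow> 'a" where
  "left_normed A [] = \<zero>\<^bsub>A\<^esub>"
| "left_normed A (x # xs) = foldl (mult A) x xs"

definition pm_scale :: "'k \<Rightarrow> ('i \<Rightarrow>\<^sub>0 'k) \<Rightarrow> ('i \<Rightarrow>\<^sub>0 'k::field)" where
  "pm_scale c = Poly_Mapping.map ((*) c)"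

text \<open>The vector space with basis \<open>'i\<close>, multiplied by bilinear extension of a table of products of
  basis elements.\<close>

definition table_algebra :: "('i \<Rightarrow> 'i \<Rightarrow> ('i \<Rightarrow>\<^sub>0 'k::field)) \<Rightarrow> ('k, 'i \<Rightarrow>\<^sub>0 'k) module" where
  "table_algebra t =
    \<lparr>carrier = UNIV,
     mult = (\<lambda>f g. \<Sum>i\<in>Poly_Mapping.keys f. \<Sum>j\<in>Poly_Mapping.keys g.
       pm_scale (Poly_Mapping.lookup f i * Poly_Mapping.lookup g j) (t i j)),
     one = 0, zero = 0, add = (+), smult = pm_scale\<rparr>"

lemma lookup_pm_scale [simp]: "Poly_Mapping.lookup (pm_scale c f) i = c * Poly_Mapping.lookup f i"
  by (simp add: pm_scale_def Poly_Mapping.map.rep_eq when_def)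

lemma abelian_group_table_algebra: "abelian_group (table_algebra t)"
  by (rule abelian_groupI)
    (auto simp: table_algebra_def ac_simps intro: exI[of _ "- x" for x] left_minus)

lemma vectorspace_table_algebra: "vectorspace class_ring (table_algebra t)"
proof (rule vectorspace.intro)
  show "Module.module class_ring (table_algebra t)"
    by (rule moduleI)
      (auto simp: class_cring.is_cring abelian_group_table_algebra class_ring_simps,
       auto simp: table_algebra_def lookup_add algebra_simps intro!: poly_mapping_eqI)
  show "field (class_ring :: 'a ring)" ..
qed

lemma mult_table_algebra:
  assumes "finite S" "Poly_Mapping.keys f \<subseteq> S" "finite T" "Poly_Mapping.keys g \<subseteq> T"
  shows "f \<otimes>\<^bsub>table_algebra t\<^esub> g =
    (\<Sum>i\<in>S. \<Sum>j\<in>T. pm_scale (Poly_Mapping.lookup f i * Poly_Mapping.lookup g j) (t i j))"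
proof -
  have z: "pm_scale 0 h = 0" for h :: "'a \<Rightarrow>\<^sub>0 'b"
    by (rule poly_mapping_eqI) simp
  have "f \<otimes>\<^bsub>table_algebra t\<^esub> g = (\<Sum>i\<in>Poly_Mapping.keys f. \<Sum>j\<in>T.
      pm_scale (Poly_Mapping.lookup f i * Poly_Mapping.lookup g j) (t i j))"
    unfolding table_algebra_def partial_object.simps monoid.simps using assms
    by (intro sum.cong refl sum.mono_neutral_left) (auto simp: z in_keys_iff)
  also have "\<dots> = (\<Sum>i\<in>S. \<Sum>j\<in>T. pm_scale (Poly_Mapping.lookup f i * Poly_Mapping.lookup g j) (t i j))"
    using assms by (intro sum.mono_neutral_left) (auto simp: z in_keys_iff)
  finally show ?thesis .
qed

lemma carrier_table_algebra [simp]: "carrier (table_algebra t) = UNIV"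
  and zero_table_algebra [simp]: "\<zero>\<^bsub>table_algebra t\<^esub> = 0"
  and add_table_algebra [simp]: "x \<oplus>\<^bsub>table_algebra t\<^esub> y = x + y"
  and smult_table_algebra [simp]: "c \<odot>\<^bsub>table_algebra t\<^esub> x = pm_scale c x"
  by (simp_all add: table_algebra_def)

lemma minus_table_algebra [simp]: "x \<ominus>\<^bsub>table_algebra t\<^esub> y = x - y"
proof -
  interpret abelian_group "table_algebra t" by (rule abelian_group_table_algebra)
  have "\<ominus>\<^bsub>table_algebra t\<^esub> y = - y"
    by (rule minus_equality) auto
  then show ?thesis by (simp add: a_minus_def)
qed

lemma nonassoc_algebra_table_algebra:
  "nonassoc_algebra (table_algebra (t :: 'b \<Rightarrow> 'b \<Rightarrow> 'b \<Rightarrow>\<^sub>0 'a::field))"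
proof (intro nonassoc_algebra.intro vectorspace_table_algebra nonassoc_algebra_axioms.intro)
  fix x y z :: "'b \<Rightarrow>\<^sub>0 'a" and c
  let ?K = Poly_Mapping.keys
  let ?U = "?K x \<union> ?K y \<union> ?K (x + y)" and ?V = "?K x \<union> ?K y \<union> ?K (pm_scale c x) \<union> ?K (pm_scale c y)"
  have fin: "finite ?U" "finite ?V" by auto
  have add: "pm_scale (a + b) h = pm_scale a h + pm_scale b h" for a b and h :: "'b \<Rightarrow>\<^sub>0 'a"
    by (rule poly_mapping_eqI) (simp add: lookup_add algebra_simps)
  have sc: "pm_scale (a * b) h = pm_scale a (pm_scale b h)" for a b and h :: "'b \<Rightarrow>\<^sub>0 'a"
    by (rule poly_mapping_eqI) (simp add: algebra_simps)
  have ss: "(\<Sum>i\<in>S. pm_scale a (h i)) = pm_scale a (\<Sum>i\<in>S. h i)" for a S and h :: "'b \<Rightarrow> 'b \<Rightarrow>\<^sub>0 'a"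
    by (rule poly_mapping_eqI) (simp add: lookup_sum sum_distrib_left)
  show "(x \<oplus>\<^bsub>table_algebra t\<^esub> y) \<otimes>\<^bsub>table_algebra t\<^esub> z =
      x \<otimes>\<^bsub>table_algebra t\<^esub> z \<oplus>\<^bsub>table_algebra t\<^esub> y \<otimes>\<^bsub>table_algebra t\<^esub> z"
    by (simp add: mult_table_algebra[OF fin(1) _ finite_keys subset_refl] le_supI1 lookup_add
        add distrib_right sum.distrib)
  show "z \<otimes>\<^bsub>table_algebra t\<^esub> (x \<oplus>\<^bsub>table_algebra t\<^esub> y) =
      z \<otimes>\<^bsub>table_algebra t\<^esub> x \<oplus>\<^bsub>table_algebra t\<^esub> z \<otimes>\<^bsub>table_algebra t\<^esub> y"
    by (simp add: mult_table_algebra[OF finite_keys subset_refl fin(1)] le_supI1 lookup_add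
        add distrib_left sum.distrib)
  show "(c \<odot>\<^bsub>table_algebra t\<^esub> x) \<otimes>\<^bsub>table_algebra t\<^esub> y =
      c \<odot>\<^bsub>table_algebra t\<^esub> (x \<otimes>\<^bsub>table_algebra t\<^esub> y)"
    by (simp add: mult_table_algebra[OF fin(2) _ fin(2)] le_supI1 mult.assoc sc[of c] ss)
  show "x \<otimes>\<^bsub>table_algebra t\<^esub> (c \<odot>\<^bsub>table_algebra t\<^esub> y) =
      c \<odot>\<^bsub>table_algebra t\<^esub> (x \<otimes>\<^bsub>table_algebra t\<^esub> y)"
    by (simp add: mult_table_algebra[OF fin(2) _ fin(2)] le_supI1 mult.left_commute[of _ c] sc[of c] ss)
qed auto

section \<open>The free Leibniz algebra\<close>

text \<open>Nonassociative words; \<open>Var i\<close> stands for the variable $x_{i+1}$.\<close>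

datatype magma = Var nat | Prod magma magma

fun letters :: "magma \<Rightarrow> nat list" where
  "letters (Var i) = [i]"
| "letters (Prod u v) = letters u @ letters v"

definition free_nonassoc :: "('k::field, magma \<Rightarrow>\<^sub>0 'k) module" where
  "free_nonassoc = table_algebra (\<lambda>u v. Poly_Mapping.single (Prod u v) 1)"

definition leibniz_ideal :: "(magma \<Rightarrow>\<^sub>0 'k::field) set" where
  "leibniz_ideal = \<Inter>{I. algebra_ideal free_nonassoc I \<and>
     (\<forall>f g h. f \<otimes>\<^bsub>free_nonassoc\<^esub> (g \<otimes>\<^bsub>free_nonassoc\<^esub> h)
        - ((f \<otimes>\<^bsub>free_nonassoc\<^esub> g) \<otimes>\<^bsub>free_nonassoc\<^esub> h - (f \<otimes>\<^bsub>free_nonassoc\<^esub> h) \<otimes>\<^bsub>free_nonassoc\<^esub> g) \<in> I)}"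

definition free_leibniz :: "('k::field, (magma \<Rightarrow>\<^sub>0 'k) set) module" where
  "free_leibniz = quotient_algebra free_nonassoc leibniz_ideal"

lemma (in abelian_group) add_minus_cancel:
  assumes "x \<in> carrier G" "y \<in> carrier G"
  shows "(x \<oplus> y) \<ominus> y = x"
  using assms by (simp add: a_minus_def a_assoc r_neg)

lemma nonassoc_algebra_free_nonassoc: "nonassoc_algebra free_nonassoc"
  unfolding free_nonassoc_def by (rule nonassoc_algebra_table_algebra)

lemma carrier_free_nonassoc [simp]: "carrier free_nonassoc = UNIV"
  and zero_free_nonassoc [simp]: "\<zero>\<^bsub>free_nonassoc\<^esub> = 0"
  and add_free_nonassoc [simp]: "x \<oplus>\<^bsub>free_nonassoc\<^esub> y = x + y"
  and smult_free_nonassoc [simp]: "c \<odot>\<^bsub>free_nonassoc\<^esub> x = pm_scale c x"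
  and minus_free_nonassoc [simp]: "x \<ominus>\<^bsub>free_nonassoc\<^esub> y = x - y"
  by (simp_all add: free_nonassoc_def)

lemma algebra_ideal_free_nonassoc_iff:
  "algebra_ideal (free_nonassoc :: ('k::field, magma \<Rightarrow>\<^sub>0 'k) module) I \<longleftrightarrow> 0 \<in> I \<and>
     (\<forall>x\<in>I. \<forall>y\<in>I. x + y \<in> I) \<and> (\<forall>c. \<forall>x\<in>I. pm_scale c x \<in> I) \<and>
     (\<forall>x\<in>I. \<forall>y. x \<otimes>\<^bsub>free_nonassoc\<^esub> y \<in> I \<and> y \<otimes>\<^bsub>free_nonassoc\<^esub> x \<in> I)"
proof -
  interpret nonassoc_algebra "free_nonassoc :: ('k, magma \<Rightarrow>\<^sub>0 'k) module"
    by (rule nonassoc_algebra_free_nonassoc)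
  show ?thesis
    unfolding algebra_ideal_def VectorSpace.subspace_def LinearCombinations.submodule_def
    using vectorspace_axioms module_axioms
    by (simp only: carrier_free_nonassoc zero_free_nonassoc add_free_nonassoc smult_free_nonassoc
        partial_object.simps) auto
qed

lemma algebra_ideal_leibniz_ideal: "algebra_ideal free_nonassoc leibniz_ideal"
  unfolding algebra_ideal_free_nonassoc_iff leibniz_ideal_def by blast

lemma leibniz_algebra_free_leibniz:
  "leibniz_algebra (free_leibniz :: ('a::field, (magma \<Rightarrow>\<^sub>0 'a) set) module)"
proof -
  interpret F: nonassoc_algebra "free_nonassoc :: ('a, magma \<Rightarrow>\<^sub>0 'a) module" by (rule nonassoc_algebra_free_nonassoc)
  interpret L: nonassoc_algebra "free_leibniz :: ('a, (magma \<Rightarrow>\<^sub>0 'a) set) module"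
    unfolding free_leibniz_def by (rule F.quotient_nonassoc_algebra[OF algebra_ideal_leibniz_ideal])
  have s: "VectorSpace.subspace class_ring leibniz_ideal (free_nonassoc :: ('a, magma \<Rightarrow>\<^sub>0 'a) module)"
    using algebra_ideal_leibniz_ideal[where ?'a = 'a] unfolding algebra_ideal_def by blast
  note q' = coset_quotient[OF F.vectorspace_axioms s, folded free_leibniz_def]
  note q = q'(1) q'(2)[unfolded carrier_free_nonassoc, OF UNIV_I]
    q'(3)[unfolded carrier_free_nonassoc add_free_nonassoc, OF UNIV_I UNIV_I] q'(4)
    q'(5)[unfolded carrier_free_nonassoc minus_free_nonassoc, OF UNIV_I UNIV_I] q'(6)
  note m = F.quotient_mult[OF algebra_ideal_leibniz_ideal, folded free_leibniz_def,
      unfolded carrier_free_nonassoc, OF UNIV_I UNIV_I]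
  have mi: "(leibniz_ideal +>\<^bsub>free_nonassoc\<^esub> x) \<ominus>\<^bsub>free_leibniz\<^esub> (leibniz_ideal +>\<^bsub>free_nonassoc\<^esub> y) =
     leibniz_ideal +>\<^bsub>free_nonassoc\<^esub> (x - y)" for x y :: "magma \<Rightarrow>\<^sub>0 'a"
  proof -
    have e: "leibniz_ideal +>\<^bsub>free_nonassoc\<^esub> x =
       (leibniz_ideal +>\<^bsub>free_nonassoc\<^esub> (x - y)) \<oplus>\<^bsub>free_leibniz\<^esub> (leibniz_ideal +>\<^bsub>free_nonassoc\<^esub> y)"
      unfolding q(3) by (simp only: diff_add_cancel)
    show ?thesis
      unfolding e by (rule L.M.add_minus_cancel[OF q(2) q(2)])
  qed
  have rel: "x \<otimes>\<^bsub>free_nonassoc\<^esub> (y \<otimes>\<^bsub>free_nonassoc\<^esub> z) - ((x \<otimes>\<^bsub>free_nonassoc\<^esub> y) \<otimes>\<^bsub>free_nonassoc\<^esub> z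
      - (x \<otimes>\<^bsub>free_nonassoc\<^esub> z) \<otimes>\<^bsub>free_nonassoc\<^esub> y) \<in> leibniz_ideal" for x y z :: "magma \<Rightarrow>\<^sub>0 'a"
    unfolding leibniz_ideal_def by blast
  show ?thesis
  proof (intro leibniz_algebra.intro leibniz_algebra_axioms.intro L.nonassoc_algebra_axioms)
    fix X Y Z :: "(magma \<Rightarrow>\<^sub>0 'a) set"
    assume "X \<in> carrier free_leibniz" "Y \<in> carrier free_leibniz" "Z \<in> carrier free_leibniz"
    then obtain x y z where xyz: "X = leibniz_ideal +>\<^bsub>free_nonassoc\<^esub> x"
      "Y = leibniz_ideal +>\<^bsub>free_nonassoc\<^esub> y" "Z = leibniz_ideal +>\<^bsub>free_nonassoc\<^esub> z"
      by (meson q(6))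
    show "X \<otimes>\<^bsub>free_leibniz\<^esub> (Y \<otimes>\<^bsub>free_leibniz\<^esub> Z) =
        (X \<otimes>\<^bsub>free_leibniz\<^esub> Y) \<otimes>\<^bsub>free_leibniz\<^esub> Z \<ominus>\<^bsub>free_leibniz\<^esub> (X \<otimes>\<^bsub>free_leibniz\<^esub> Z) \<otimes>\<^bsub>free_leibniz\<^esub> Y"
      unfolding xyz m mi q(5) using rel by blast
  qed
qed

definition gen :: "nat \<Rightarrow> (magma \<Rightarrow>\<^sub>0 'k::field) set" where
  "gen i = leibniz_ideal +>\<^bsub>free_nonassoc\<^esub> Poly_Mapping.single (Var i) 1"

section \<open>Identities, relatively free algebras and codimensions\<close>

fun word_eval :: "('k::field, 'a) module \<Rightarrow> (nat \<Rightarrow> 'a) \<Rightarrow> magma \<Rightarrow> 'a" where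
  "word_eval A s (Var i) = s i"
| "word_eval A s (Prod u v) = word_eval A s u \<otimes>\<^bsub>A\<^esub> word_eval A s v"

definition poly_eval :: "('k::field, 'a) module \<Rightarrow> (nat \<Rightarrow> 'a) \<Rightarrow> (magma \<Rightarrow>\<^sub>0 'k) \<Rightarrow> 'a" where
  "poly_eval A s p =
     (\<Oplus>\<^bsub>A\<^esub>w\<in>Poly_Mapping.keys p. Poly_Mapping.lookup p w \<odot>\<^bsub>A\<^esub> word_eval A s w)"

lemma (in nonassoc_algebra) mult_zero:
  assumes "x \<in> carrier A"
  shows "x \<otimes>\<^bsub>A\<^esub> \<zero>\<^bsub>A\<^esub> = \<zero>\<^bsub>A\<^esub>" "\<zero>\<^bsub>A\<^esub> \<otimes>\<^bsub>A\<^esub> x = \<zero>\<^bsub>A\<^esub>"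
proof -
  have l: "0 \<odot>\<^bsub>A\<^esub> y = \<zero>\<^bsub>A\<^esub>" if "y \<in> carrier A" for y
    using lmult_0[OF that] by simp
  show "x \<otimes>\<^bsub>A\<^esub> \<zero>\<^bsub>A\<^esub> = \<zero>\<^bsub>A\<^esub>"
    using mult_smult_right[OF assms M.zero_closed, of 0]
    by (simp only: l assms M.zero_closed mult_closed)
  show "\<zero>\<^bsub>A\<^esub> \<otimes>\<^bsub>A\<^esub> x = \<zero>\<^bsub>A\<^esub>"
    using mult_smult_left[OF M.zero_closed assms, of 0]
    by (simp only: l assms M.zero_closed mult_closed)
qed

lemma pm_scale_zero: "pm_scale c 0 = 0"
  by (rule poly_mapping_eqI) simp

lemma pm_scale_add: "pm_scale c (p + q) = pm_scale c p + pm_scale c q"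
  by (rule poly_mapping_eqI) (simp add: lookup_add algebra_simps)

lemma pm_scale_single: "pm_scale c (Poly_Mapping.single w d) = Poly_Mapping.single w (c * d)"
  by (rule poly_mapping_eqI) (simp add: lookup_single when_def)

lemma poly_mapping_single_induct [case_names zero add]:
  assumes "P 0" and "\<And>f w c. P f \<Longrightarrow> P (f + Poly_Mapping.single w c)"
  shows "P (f :: 'i \<Rightarrow>\<^sub>0 'k::field)"
proof (induction f rule: Poly_Mapping.update_induct)
  case const
  show ?case using assms(1) by simp
next
  case (update f a b)
  have "Poly_Mapping.update a b f = f + Poly_Mapping.single a b"
    using update(1) by (intro poly_mapping_eqI)
      (auto simp: lookup_update lookup_add lookup_single when_def in_keys_iff)
  then show ?case using assms(2)[OF update(3)] by simp
qed

context nonassoc_algebra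
begin

context
  fixes s :: "nat \<Rightarrow> 'a"
  assumes s: "range s \<subseteq> carrier A"
begin

lemma word_eval_closed [simp]: "word_eval A s w \<in> carrier A"
  using s by (induction w) (auto simp: mult_closed)

lemma term_closed [simp]: "c \<odot>\<^bsub>A\<^esub> word_eval A s w \<in> carrier A"
  by (rule smult_closed) auto

lemma poly_eval_closed [simp]: "poly_eval A s p \<in> carrier A"
  unfolding poly_eval_def by (rule M.finsum_closed) simp

lemma zero_term [simp]: "0 \<odot>\<^bsub>A\<^esub> word_eval A s w = \<zero>\<^bsub>A\<^esub>"
  using lmult_0[OF word_eval_closed] by simp

lemma poly_eval_superset:
  assumes "finite S" "Poly_Mapping.keys p \<subseteq> S"
  shows "poly_eval A s p =
    (\<Oplus>\<^bsub>A\<^esub>w\<in>S. Poly_Mapping.lookup p w \<odot>\<^bsub>A\<^esub> word_eval A s w)"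
  unfolding poly_eval_def
  using assms by (intro M.add.finprod_mono_neutral_cong_left) (auto simp: in_keys_iff)

lemma poly_eval_add: "poly_eval A s (p + q) = poly_eval A s p \<oplus>\<^bsub>A\<^esub> poly_eval A s q"
proof -
  let ?S = "Poly_Mapping.keys p \<union> Poly_Mapping.keys q \<union> Poly_Mapping.keys (p + q)"
  have S: "finite ?S" by simp
  have d: "(a + b) \<odot>\<^bsub>A\<^esub> word_eval A s w = a \<odot>\<^bsub>A\<^esub> word_eval A s w \<oplus>\<^bsub>A\<^esub> b \<odot>\<^bsub>A\<^esub> word_eval A s w" for a b w
    using smult_l_distr[of a b "word_eval A s w"] by simp
  show ?thesis
    by (subst (1 2 3) poly_eval_superset[OF S])
      (auto simp: lookup_add d intro!: M.finsum_addf)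
qed

lemma poly_eval_single: "poly_eval A s (Poly_Mapping.single w c) = c \<odot>\<^bsub>A\<^esub> word_eval A s w"
  by (subst poly_eval_superset[of "{w}"]) auto

lemma poly_eval_zero: "poly_eval A s 0 = \<zero>\<^bsub>A\<^esub>"
  by (simp add: poly_eval_def)

lemma poly_eval_scale: "poly_eval A s (pm_scale c p) = c \<odot>\<^bsub>A\<^esub> poly_eval A s p"
proof (induction p rule: poly_mapping_single_induct)
  case zero
  show ?case
    by (simp only: pm_scale_zero poly_eval_zero) simp
next
  case (add f w d)
  have "(c * d) \<odot>\<^bsub>A\<^esub> word_eval A s w = c \<odot>\<^bsub>A\<^esub> (d \<odot>\<^bsub>A\<^esub> word_eval A s w)"
    using smult_assoc1[of c d "word_eval A s w"] by simp
  moreover have "c \<odot>\<^bsub>A\<^esub> (poly_eval A s f \<oplus>\<^bsub>A\<^esub> d \<odot>\<^bsub>A\<^esub> word_eval A s w) =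
      c \<odot>\<^bsub>A\<^esub> poly_eval A s f \<oplus>\<^bsub>A\<^esub> c \<odot>\<^bsub>A\<^esub> (d \<odot>\<^bsub>A\<^esub> word_eval A s w)"
    using smult_r_distr[of c "poly_eval A s f" "d \<odot>\<^bsub>A\<^esub> word_eval A s w"] by simp
  ultimately show ?case
    by (simp only: pm_scale_add pm_scale_single poly_eval_add poly_eval_single add.IH)
qed

lemma poly_eval_minus: "poly_eval A s (p - q) = poly_eval A s p \<ominus>\<^bsub>A\<^esub> poly_eval A s q"
proof -
  have "p - q = p + pm_scale (- 1) q"
    by (rule poly_mapping_eqI) (simp add: lookup_add lookup_minus)
  then show ?thesis
    by (simp only: poly_eval_add poly_eval_scale minus_eq_smult[OF poly_eval_closed])
qed

lemma poly_eval_mult: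
  "poly_eval A s (p \<otimes>\<^bsub>free_nonassoc\<^esub> q) = poly_eval A s p \<otimes>\<^bsub>A\<^esub> poly_eval A s q"
proof -
  interpret F: nonassoc_algebra "free_nonassoc :: ('k, magma \<Rightarrow>\<^sub>0 'k) module"
    by (rule nonassoc_algebra_free_nonassoc)
  note z = mult_zero
  have zf: "p \<otimes>\<^bsub>free_nonassoc\<^esub> 0 = 0" "0 \<otimes>\<^bsub>free_nonassoc\<^esub> p = 0" for p :: "magma \<Rightarrow>\<^sub>0 'k"
    by (simp_all add: free_nonassoc_def table_algebra_def)
  have ss: "poly_eval A s (Poly_Mapping.single u c \<otimes>\<^bsub>free_nonassoc\<^esub> Poly_Mapping.single v d) =
      (c \<odot>\<^bsub>A\<^esub> word_eval A s u) \<otimes>\<^bsub>A\<^esub> (d \<odot>\<^bsub>A\<^esub> word_eval A s v)" for u v c d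
  proof -
    have "Poly_Mapping.single u c \<otimes>\<^bsub>free_nonassoc\<^esub> Poly_Mapping.single v d =
        Poly_Mapping.single (Prod u v) (c * d)"
      unfolding free_nonassoc_def
      by (subst mult_table_algebra[of "{u}" _ "{v}"]) (auto simp: pm_scale_single)
    moreover have "(c * d) \<odot>\<^bsub>A\<^esub> (word_eval A s u \<otimes>\<^bsub>A\<^esub> word_eval A s v) =
        c \<odot>\<^bsub>A\<^esub> (d \<odot>\<^bsub>A\<^esub> (word_eval A s u \<otimes>\<^bsub>A\<^esub> word_eval A s v))"
      using smult_assoc1[of c d "word_eval A s u \<otimes>\<^bsub>A\<^esub> word_eval A s v"]
      by (simp add: mult_closed)
    ultimately show ?thesis
      by (simp only: poly_eval_single word_eval.simps mult_smult_left[OF word_eval_closed term_closed]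
          mult_smult_right[OF word_eval_closed word_eval_closed])
  qed
  have s1: "poly_eval A s (Poly_Mapping.single u c \<otimes>\<^bsub>free_nonassoc\<^esub> q) =
      (c \<odot>\<^bsub>A\<^esub> word_eval A s u) \<otimes>\<^bsub>A\<^esub> poly_eval A s q" for u c q
  proof (induction q rule: poly_mapping_single_induct)
    case zero
    show ?case by (simp only: zf poly_eval_zero z term_closed)
  next
    case (add f w d)
    show ?case
      using F.mult_add_right[of f "Poly_Mapping.single w d" "Poly_Mapping.single u c"]
      by (simp add: poly_eval_add poly_eval_single ss add.IH mult_add_right)
  qed
  show ?thesis
  proof (induction p rule: poly_mapping_single_induct)
    case zero
    show ?case by (simp only: zf poly_eval_zero z poly_eval_closed)
  next
    case (add f w d)
    show ?case
      using F.mult_add_left[of f "Poly_Mapping.single w d" q]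
      by (simp add: poly_eval_add poly_eval_single s1 add.IH mult_add_left)
  qed
qed

end

end

text \<open>Elements of the free Leibniz algebra are cosets \<open>f\<close> of nonassociative polynomials. If \<open>A\<close> is a
  Leibniz algebra, \<open>poly_eval A s\<close> is constant on each of them.\<close>

definition identities :: "('k::field, 'a) module \<Rightarrow> (magma \<Rightarrow>\<^sub>0 'k) set set" where
  "identities A = {f \<in> carrier free_leibniz.
     \<forall>s. range s \<subseteq> carrier A \<longrightarrow> (\<forall>p\<in>f. poly_eval A s p = \<zero>\<^bsub>A\<^esub>)}"

lemma (in leibniz_algebra) poly_eval_leibniz_ideal:
  assumes "range s \<subseteq> carrier A" and p: "p \<in> leibniz_ideal"
  shows "poly_eval A s p = \<zero>\<^bsub>A\<^esub>"
proof -
  note ev = poly_eval_zero[OF assms(1)] poly_eval_add[OF assms(1)] poly_eval_scale[OF assms(1)]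
    poly_eval_minus[OF assms(1)] poly_eval_mult[OF assms(1)]
  note cl = poly_eval_closed[OF assms(1)]
  note z = mult_zero
  let ?N = "{p. poly_eval A s p = \<zero>\<^bsub>A\<^esub>}"
  have "algebra_ideal free_nonassoc ?N"
    unfolding algebra_ideal_free_nonassoc_iff mem_Collect_eq ev
  proof (intro conjI ballI allI)
    fix c
    show "c \<odot>\<^bsub>A\<^esub> poly_eval A s x = \<zero>\<^bsub>A\<^esub>" if "x \<in> ?N" for x
      using that by simp
  qed (simp_all add: z cl)
  moreover have "f \<otimes>\<^bsub>free_nonassoc\<^esub> (g \<otimes>\<^bsub>free_nonassoc\<^esub> h) - ((f \<otimes>\<^bsub>free_nonassoc\<^esub> g) \<otimes>\<^bsub>free_nonassoc\<^esub> h
      - (f \<otimes>\<^bsub>free_nonassoc\<^esub> h) \<otimes>\<^bsub>free_nonassoc\<^esub> g) \<in> ?N" for f g h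
    unfolding mem_Collect_eq ev leibniz[OF cl cl cl] a_minus_def
    by (intro M.r_neg M.a_closed M.a_inv_closed mult_closed cl)
  ultimately show ?thesis
    using p unfolding leibniz_ideal_def by blast
qed

lemma (in leibniz_algebra) coset_in_identities_iff:
  "leibniz_ideal +>\<^bsub>free_nonassoc\<^esub> p \<in> identities A \<longleftrightarrow>
     (\<forall>s. range s \<subseteq> carrier A \<longrightarrow> poly_eval A s p = \<zero>\<^bsub>A\<^esub>)"
proof -
  have z: "0 \<in> (leibniz_ideal :: (magma \<Rightarrow>\<^sub>0 'k) set)"
    using algebra_ideal_leibniz_ideal unfolding algebra_ideal_free_nonassoc_iff by blast
  have c: "leibniz_ideal +>\<^bsub>free_nonassoc\<^esub> p = {h + p | h. h \<in> leibniz_ideal}"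
    unfolding a_r_coset_def' by auto
  have "leibniz_ideal +>\<^bsub>free_nonassoc\<^esub> p \<in> carrier free_leibniz"
    unfolding free_leibniz_def quotient_algebra_def A_RCOSETS_def' partial_object.simps
      carrier_free_nonassoc by blast
  moreover have "poly_eval A s q = poly_eval A s p"
    if s: "range s \<subseteq> carrier A" and q: "q \<in> leibniz_ideal +>\<^bsub>free_nonassoc\<^esub> p" for s q
  proof -
    from q obtain h where h: "h \<in> leibniz_ideal" "q = h + p" unfolding c by blast
    show ?thesis
      unfolding h(2) poly_eval_add[OF s] poly_eval_leibniz_ideal[OF s h(1)]
      by (rule M.l_zero[OF poly_eval_closed[OF s]])
  qed
  moreover have "p \<in> leibniz_ideal +>\<^bsub>free_nonassoc\<^esub> p"
    unfolding c using z add_0_left[of p] by (metis (mono_tags, lifting) mem_Collect_eq)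
  ultimately show ?thesis
    unfolding identities_def mem_Collect_eq by metis
qed

definition relatively_free :: "('k::field, 'a) module \<Rightarrow> ('k, (magma \<Rightarrow>\<^sub>0 'k) set set) module" where
  "relatively_free A = quotient_algebra free_leibniz (identities A)"

lemma (in leibniz_algebra) algebra_ideal_identities: "algebra_ideal free_leibniz (identities A)"
proof -
  interpret F: nonassoc_algebra "free_nonassoc :: ('k, magma \<Rightarrow>\<^sub>0 'k) module"
    by (rule nonassoc_algebra_free_nonassoc)
  interpret L: leibniz_algebra "free_leibniz :: ('k, (magma \<Rightarrow>\<^sub>0 'k) set) module"
    by (rule leibniz_algebra_free_leibniz)
  have s: "VectorSpace.subspace class_ring leibniz_ideal (free_nonassoc :: ('k, magma \<Rightarrow>\<^sub>0 'k) module)"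
    using algebra_ideal_leibniz_ideal[where ?'a = 'k] unfolding algebra_ideal_def by blast
  note q' = coset_quotient[OF F.vectorspace_axioms s, folded free_leibniz_def]
  note q = q'(2)[unfolded carrier_free_nonassoc, OF UNIV_I]
    q'(3)[unfolded carrier_free_nonassoc add_free_nonassoc, OF UNIV_I UNIV_I]
    q'(4)[unfolded carrier_free_nonassoc smult_free_nonassoc, OF UNIV_I]
  note m = F.quotient_mult[OF algebra_ideal_leibniz_ideal, folded free_leibniz_def,
      unfolded carrier_free_nonassoc, OF UNIV_I UNIV_I]
  have ex: "\<exists>p. X = leibniz_ideal +>\<^bsub>free_nonassoc\<^esub> p" if "X \<in> carrier free_leibniz" for X :: "(magma \<Rightarrow>\<^sub>0 'k) set"
    using q'(6)[OF that] by blast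
  have sub: "identities A \<subseteq> carrier free_leibniz"
    unfolding identities_def by blast
  note z = mult_zero
  have zero: "\<zero>\<^bsub>free_leibniz\<^esub> = leibniz_ideal +>\<^bsub>free_nonassoc\<^esub> (0 :: magma \<Rightarrow>\<^sub>0 'k)"
    unfolding free_leibniz_def quotient_algebra_def a_r_coset_def' ring.simps add_free_nonassoc
    by (simp only: add_0_right UN_singleton)
  show ?thesis
    unfolding algebra_ideal_def
  proof (intro conjI ballI VectorSpace.subspace.intro LinearCombinations.submodule.intro
      L.vectorspace_axioms L.module_axioms sub)
    show "\<zero>\<^bsub>free_leibniz\<^esub> \<in> identities A"
      unfolding zero coset_in_identities_iff by (simp add: poly_eval_zero)
    fix X assume X: "X \<in> identities A"
    then obtain p where p: "X = leibniz_ideal +>\<^bsub>free_nonassoc\<^esub> p" using ex sub by blast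
    note X' = X[unfolded p coset_in_identities_iff]
    {
      fix c :: 'k
      show "c \<odot>\<^bsub>free_leibniz\<^esub> X \<in> identities A"
        unfolding p q coset_in_identities_iff using X' by (simp add: poly_eval_scale)
    next
      fix Y assume Y: "Y \<in> identities A"
      then obtain r where r: "Y = leibniz_ideal +>\<^bsub>free_nonassoc\<^esub> r" using ex sub by blast
      note Y' = Y[unfolded r coset_in_identities_iff]
      show "X \<oplus>\<^bsub>free_leibniz\<^esub> Y \<in> identities A"
        unfolding p r q coset_in_identities_iff using X' Y' by (simp add: poly_eval_add)
    next
      fix Y :: "(magma \<Rightarrow>\<^sub>0 'k) set" assume "Y \<in> carrier free_leibniz"
      then obtain r where r: "Y = leibniz_ideal +>\<^bsub>free_nonassoc\<^esub> r" using ex by blast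
      show "X \<otimes>\<^bsub>free_leibniz\<^esub> Y \<in> identities A"
        unfolding p r m coset_in_identities_iff
        using X' by (simp add: poly_eval_mult z poly_eval_closed)
      show "Y \<otimes>\<^bsub>free_leibniz\<^esub> X \<in> identities A"
        unfolding p r m coset_in_identities_iff
        using X' by (simp add: poly_eval_mult z poly_eval_closed)
    }
  qed
qed

lemma (in leibniz_algebra) nonassoc_algebra_relatively_free:
  "nonassoc_algebra (relatively_free A)"
proof -
  interpret L: leibniz_algebra "free_leibniz :: ('k, (magma \<Rightarrow>\<^sub>0 'k) set) module"
    by (rule leibniz_algebra_free_leibniz)
  show ?thesis
    unfolding relatively_free_def
    by (rule L.quotient_nonassoc_algebra[OF algebra_ideal_identities])
qed

text \<open>The images of \<open>B\<close> form a basis as a family indexed by \<open>B\<close>, so distinct elements of \<open>B\<close> have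
  distinct images.\<close>

definition images_form_basis ::
  "('k::field, 'a) module \<Rightarrow> (magma \<Rightarrow>\<^sub>0 'k) set set \<Rightarrow> bool" where
  "images_form_basis A B \<longleftrightarrow>
     inj_on (\<lambda>f. identities A +>\<^bsub>free_leibniz\<^esub> f) B \<and>
     vectorspace.basis class_ring (relatively_free A) ((\<lambda>f. identities A +>\<^bsub>free_leibniz\<^esub> f) ` B)"

text \<open>The multilinear polynomials in $x_1,\dots,x_n$.\<close>

definition multilinear :: "nat \<Rightarrow> (magma \<Rightarrow>\<^sub>0 'k::field) set set" where
  "multilinear n = {leibniz_ideal +>\<^bsub>free_nonassoc\<^esub> p | p.
     \<forall>w\<in>Poly_Mapping.keys p. distinct (letters w) \<and> set (letters w) = {..<n}}"

definition codimension :: "('k::field, 'a) module \<Rightarrow> nat \<Rightarrow> nat" where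
  "codimension A n = vectorspace.dim class_ring
     (quotient_algebra (free_leibniz\<lparr>carrier := multilinear n\<rparr>) (multilinear n \<inter> identities A))"

definition codim_exponent :: "('k::field, 'a) module \<Rightarrow> real" where
  "codim_exponent A = lim (\<lambda>n. root n (real (codimension A n)))"

section \<open>The algebra $L_9$ and its monomials\<close>

datatype idx = E1 | E2 | E3

fun L9_table :: "'k::field \<Rightarrow> idx \<Rightarrow> idx \<Rightarrow> (idx \<Rightarrow>\<^sub>0 'k)" where
  "L9_table \<alpha> E1 E3 = Poly_Mapping.single E2 1"
| "L9_table \<alpha> E2 E3 = Poly_Mapping.single E1 \<alpha>"
| "L9_table \<alpha> _ _ = 0"

definition L9 :: "'k::field \<Rightarrow> ('k, idx \<Rightarrow>\<^sub>0 'k) module" where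
  "L9 \<alpha> = table_algebra (L9_table \<alpha>)"

lemma leibniz_algebra_L9: "leibniz_algebra (L9 \<alpha>)"
proof -
  have m: "f \<otimes>\<^bsub>L9 \<alpha>\<^esub> g =
      Poly_Mapping.single E1 (\<alpha> * (Poly_Mapping.lookup f E2 * Poly_Mapping.lookup g E3))
      + Poly_Mapping.single E2 (Poly_Mapping.lookup f E1 * Poly_Mapping.lookup g E3)" for f g
  proof -
    have "Poly_Mapping.keys h \<subseteq> {E1, E2, E3}" for h :: "idx \<Rightarrow>\<^sub>0 'a"
      using idx.exhaust by auto
    then show ?thesis
      unfolding L9_def
      by (subst mult_table_algebra[of "{E1, E2, E3}" _ "{E1, E2, E3}"])
        (auto intro!: poly_mapping_eqI simp: lookup_add lookup_single when_def)
  qed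
  have mm: "f \<ominus>\<^bsub>L9 \<alpha>\<^esub> g = f - g" for f g
    by (simp add: L9_def)
  show ?thesis
  proof (intro leibniz_algebra.intro leibniz_algebra_axioms.intro)
    show "nonassoc_algebra (L9 \<alpha>)"
      unfolding L9_def by (rule nonassoc_algebra_table_algebra)
    fix x y z
    show "x \<otimes>\<^bsub>L9 \<alpha>\<^esub> (y \<otimes>\<^bsub>L9 \<alpha>\<^esub> z) =
        (x \<otimes>\<^bsub>L9 \<alpha>\<^esub> y) \<otimes>\<^bsub>L9 \<alpha>\<^esub> z \<ominus>\<^bsub>L9 \<alpha>\<^esub> (x \<otimes>\<^bsub>L9 \<alpha>\<^esub> z) \<otimes>\<^bsub>L9 \<alpha>\<^esub> y"
      by (simp add: m mm lookup_add lookup_single algebra_simps)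
  qed
qed

text \<open>For \<open>js = [j\<^sub>1, \<dots>, j\<^sub>n]\<close> and \<open>ms = [m\<^sub>1, \<dots>, m\<^sub>n]\<close>, the left-normed monomial
  $x_{j_1}^{(m_1)}\cdots x_{j_n}^{(m_n)}$. Lists are indexed from 0, so \<open>ms ! 0\<close> is $m_1$.\<close>

definition power_monomial :: "nat list \<Rightarrow> nat list \<Rightarrow> (magma \<Rightarrow>\<^sub>0 'k::field) set" where
  "power_monomial js ms =
     left_normed free_leibniz (concat (map2 (\<lambda>j m. replicate m (gen j)) js ms))"

definition L9_index :: "nat list \<Rightarrow> nat list \<Rightarrow> bool" where
  "L9_index js ms \<longleftrightarrow> js \<noteq> [] \<and> length ms = length js \<and> (\<forall>m\<in>set ms. 1 \<le> m) \<and>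
     sorted_wrt (<) (tl js) \<and> hd js \<notin> set (tl js)"

definition B_L9 :: "(magma \<Rightarrow>\<^sub>0 'k::field) set set" where
  "B_L9 = {power_monomial js ms | js ms. L9_index js ms}"

definition B_L9_odd :: "nat \<Rightarrow> (magma \<Rightarrow>\<^sub>0 'k::field) set set" where
  "B_L9_odd q = {power_monomial js ms | js ms. L9_index js ms \<and>
     ms ! 0 \<le> q \<and> (\<forall>i. 1 \<le> i \<and> i < length ms \<longrightarrow> ms ! i < q)}"

definition B_L9_even :: "nat \<Rightarrow> (magma \<Rightarrow>\<^sub>0 'k::field) set set" where
  "B_L9_even q = {power_monomial js ms | js ms. L9_index js ms \<and>
     ms ! 0 < 2 * q \<and>
     (1 < length ms \<longrightarrow> ms ! 1 < 2 * q - 1) \<and>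
     (\<forall>i. 2 \<le> i \<and> i < length ms \<longrightarrow> ms ! i < q) \<and>
     (1 < length ms \<and> 1 < ms ! 0 \<longrightarrow> ms ! 1 < q)}"

end

theory Submission
  imports Defs "HOL-Computational_Algebra.Polynomial"
begin

text \<open>
  In \<open>L\<^sub>9\<close> the product \<open>u v\<close> depends on \<open>v\<close> only through its \<open>e\<^sub>3\<close>-coordinate, and the square of right
  multiplication by \<open>e\<^sub>3\<close> is \<open>\<alpha>\<close> times the projection to the span of \<open>e\<^sub>1\<close> and \<open>e\<^sub>2\<close>. Hence a word vanishes
  identically unless it is left-normed, and the value of \<open>x y\<^sub>1 \<dots> y\<^sub>k\<close> is determined up to a power of \<open>\<alpha>\<close> by
  \<open>x\<close>, the parity of \<open>k\<close> (and whether \<open>k = 0\<close>) and the product of the \<open>e\<^sub>3\<close>-coordinates of the \<open>y\<^sub>i\<close>. As functions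
  of these coordinates the products are characters of a monoid, so by Dedekind's lemma they are linearly
  independent as soon as they are distinct. Over an infinite field different multisets of letters give different
  functions. If \<open>K\<close> has \<open>q\<close> elements, exponents can be reduced by \<open>t\<^sup>q = t\<close>. For odd \<open>q\<close> this preserves the
  parity of \<open>k\<close>; for even \<open>q\<close> it flips it, so that every nonconstant reduced function occurs with
  both parities, and the second one is obtained by adding \<open>q - 1\<close> to the exponent of one chosen letter.
\<close>

section \<open>Bases from linear images of formal linear combinations\<close>

lemma poly_mapping_keys_induct [consumes 1, case_names zero add]:
  fixes p :: "'i \<Rightarrow>\<^sub>0 'k::field"
  assumes "Poly_Mapping.keys p \<subseteq> S" and "P 0"
    and "\<And>q w c. Poly_Mapping.keys q \<subseteq> S \<Longrightarrow> w \<in> S \<Longrightarrow> P q \<Longrightarrow> P (q + Poly_Mapping.single w c)"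
  shows "P p"
  using assms(1)
proof (induction p rule: Poly_Mapping.update_induct)
  case const
  show ?case by fact
next
  case (update f a b)
  have "Poly_Mapping.update a b f = f + Poly_Mapping.single a b"
    using update(1) by (intro poly_mapping_eqI)
      (auto simp: lookup_update lookup_add lookup_single when_def in_keys_iff)
  moreover have "Poly_Mapping.keys (Poly_Mapping.update a b f) = insert a (Poly_Mapping.keys f)"
    using update(2) by (auto simp: keys_update)
  ultimately show ?case
    using update assms(3)[of f a b] by auto
qed

lemma keys_pm_scale: "Poly_Mapping.keys (pm_scale c p) \<subseteq> Poly_Mapping.keys p"
  by (auto simp: in_keys_iff)

lemma keys_sum_single: "Poly_Mapping.keys (\<Sum>w\<in>F. Poly_Mapping.single w (a w)) \<subseteq> F"
  using keys_sum[of "\<lambda>w. Poly_Mapping.single w (a w)" F]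
  by (cases "finite F") (auto split: if_splits)

text \<open>The kernel condition makes the images of \<open>T\<close> independent, and the span
  condition rewrites every generator indexed by \<open>S\<close> through \<open>T\<close>. Since a
  basis is a set of vectors, distinctness of the images is a separate conclusion.\<close>

lemma linear_image_basis:
  fixes Q :: "('k::field, 'a) module" and h :: "('i \<Rightarrow>\<^sub>0 'k) \<Rightarrow> 'a"
  assumes Q: "vectorspace class_ring Q"
    and onto: "carrier Q = h ` {p. Poly_Mapping.keys p \<subseteq> S}"
    and add: "\<And>p q. Poly_Mapping.keys p \<subseteq> S \<Longrightarrow> Poly_Mapping.keys q \<subseteq> S \<Longrightarrow> h (p + q) = h p \<oplus>\<^bsub>Q\<^esub> h q"
    and scale: "\<And>c p. Poly_Mapping.keys p \<subseteq> S \<Longrightarrow> h (pm_scale c p) = c \<odot>\<^bsub>Q\<^esub> h p"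
    and TS: "T \<subseteq> S"
    and ker: "\<And>p. Poly_Mapping.keys p \<subseteq> T \<Longrightarrow> h p = \<zero>\<^bsub>Q\<^esub> \<Longrightarrow> p = 0"
    and span: "\<And>w. w \<in> S \<Longrightarrow> \<exists>p. Poly_Mapping.keys p \<subseteq> T \<and> h (Poly_Mapping.single w 1) = h p"
  shows "inj_on (\<lambda>w. h (Poly_Mapping.single w 1)) T"
    and "vectorspace.basis class_ring Q ((\<lambda>w. h (Poly_Mapping.single w 1)) ` T)"
proof -
  interpret V: vectorspace "class_ring :: 'k ring" Q by fact
  let ?b = "\<lambda>w. h (Poly_Mapping.single w 1)"
  have hc: "h p \<in> carrier Q" if "Poly_Mapping.keys p \<subseteq> S" for p
    using that onto by blast
  have bc: "?b w \<in> carrier Q" if "w \<in> S" for w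
    using that by (intro hc) auto
  have h0: "h 0 = \<zero>\<^bsub>Q\<^esub>"
    using scale[of 0 0] V.lmult_0[OF hc[of 0]] by (simp add: pm_scale_zero)
  have single: "h (Poly_Mapping.single w c) = c \<odot>\<^bsub>Q\<^esub> ?b w" if "w \<in> S" for w c
    using scale[of "Poly_Mapping.single w 1" c] that by (auto simp: pm_scale_single)
  have sc: "c \<odot>\<^bsub>Q\<^esub> x \<in> carrier Q" if "x \<in> carrier Q" for c x
    using V.smult_closed[of c x] that by simp
  have step: "h (q + Poly_Mapping.single w c) = h q \<oplus>\<^bsub>Q\<^esub> c \<odot>\<^bsub>Q\<^esub> ?b w"
    if "Poly_Mapping.keys q \<subseteq> S" "w \<in> S" for q w c
  proof -
    have "Poly_Mapping.keys (Poly_Mapping.single w c) \<subseteq> S" using that by auto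
    then show ?thesis by (simp only: add[OF that(1)] single[OF that(2), of c])
  qed
  have sum: "h (\<Sum>w\<in>F. Poly_Mapping.single w (a w)) = (\<Oplus>\<^bsub>Q\<^esub>w\<in>F. a w \<odot>\<^bsub>Q\<^esub> ?b w)"
    if "finite F" "F \<subseteq> S" for F a
    using that
  proof (induction F rule: finite_induct)
    case empty
    show ?case by (simp add: h0)
  next
    case (insert w F)
    have "Poly_Mapping.keys (\<Sum>w\<in>F. Poly_Mapping.single w (a w)) \<subseteq> S"
      using insert.prems keys_sum_single[of a F] by blast
    moreover have "Poly_Mapping.keys (Poly_Mapping.single w (a w)) \<subseteq> S"
      using insert.prems by auto
    ultimately have "h (\<Sum>w\<in>insert w F. Poly_Mapping.single w (a w)) =
        a w \<odot>\<^bsub>Q\<^esub> ?b w \<oplus>\<^bsub>Q\<^esub> h (\<Sum>w\<in>F. Poly_Mapping.single w (a w))"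
      using insert.hyps insert.prems by (simp add: add single[symmetric])
    also have "\<dots> = (\<Oplus>\<^bsub>Q\<^esub>w\<in>insert w F. a w \<odot>\<^bsub>Q\<^esub> ?b w)"
      using insert by (subst V.M.finsum_insert) (auto intro!: sc bc)
    finally show ?case .
  qed
  have sum0: "a w = 0" if F: "finite F" "F \<subseteq> T" "w \<in> F" and z: "(\<Oplus>\<^bsub>Q\<^esub>w\<in>F. a w \<odot>\<^bsub>Q\<^esub> ?b w) = \<zero>\<^bsub>Q\<^esub>" for F a w
  proof -
    let ?p = "\<Sum>w\<in>F. Poly_Mapping.single w (a w)"
    have "F \<subseteq> S" using F TS by blast
    then have "h ?p = \<zero>\<^bsub>Q\<^esub>" using z by (simp only: sum[OF F(1)])
    then have "?p = 0"
      using keys_sum_single[of a F] F(2) by (intro ker) blast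
    moreover have "Poly_Mapping.lookup ?p w = a w"
      using F by (simp add: lookup_sum lookup_single when_def)
    ultimately show ?thesis by simp
  qed
  show inj: "inj_on ?b T"
  proof (rule inj_onI, rule ccontr)
    fix u w assume uw: "u \<in> T" "w \<in> T" "?b u = ?b w" "u \<noteq> w"
    have k: "Poly_Mapping.keys (Poly_Mapping.single u (1::'k)) \<subseteq> T" "Poly_Mapping.keys (Poly_Mapping.single w (- 1 :: 'k)) \<subseteq> T"
      using uw by auto
    let ?p = "Poly_Mapping.single u 1 + Poly_Mapping.single w (- 1) :: 'i \<Rightarrow>\<^sub>0 'k"
    have "h ?p = ?b u \<oplus>\<^bsub>Q\<^esub> (- 1) \<odot>\<^bsub>Q\<^esub> ?b w"
      using k TS uw by (subst add) (auto simp: single[symmetric])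
    also have "\<dots> = \<zero>\<^bsub>Q\<^esub>"
      using V.smult_minus_1[of "?b w"] bc[of w] uw TS by (auto simp: class_ring_simps V.M.r_neg)
    finally have "?p = 0"
      using k keys_add[of "Poly_Mapping.single u 1" "Poly_Mapping.single w (- 1 :: 'k)"] by (intro ker) auto
    then have "Poly_Mapping.lookup ?p u = 0" by simp
    then show False using uw(4) by (simp add: lookup_add lookup_single)
  qed
  have bT: "?b ` T \<subseteq> carrier Q" using bc TS by blast
  have "V.lin_indpt (?b ` T)"
  proof
    assume "V.lin_dep (?b ` T)"
    then obtain A a v where A: "finite A" "A \<subseteq> ?b ` T" "V.lincomb a A = \<zero>\<^bsub>Q\<^esub>" "v \<in> A" "a v \<noteq> 0"
      unfolding V.lin_dep_def by auto
    \<comment> \<open>Lifting the finite set \<open>A\<close> to indices turns the dependence into a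
      sum over indices, to which \<open>sum0\<close> applies.\<close>
    obtain F where F: "F \<subseteq> T" "finite F" "A = ?b ` F"
      using finite_subset_image[OF A(1,2)] by blast
    have "V.lincomb a A = (\<Oplus>\<^bsub>Q\<^esub>w\<in>F. a (?b w) \<odot>\<^bsub>Q\<^esub> ?b w)"
      unfolding V.lincomb_def F(3)
      by (rule V.M.finsum_reindex) (use F TS inj bc sc in \<open>auto intro: inj_on_subset\<close>)
    then show False
      using sum0[OF F(2,1), of _ "\<lambda>w. a (?b w)"] A(3-5) F(3) by auto
  qed
  moreover have "V.span (?b ` T) = carrier Q"
  proof
    show "V.span (?b ` T) \<subseteq> carrier Q" by (rule V.span_is_subset2[OF bT])
    interpret sp: LinearCombinations.submodule class_ring "V.span (?b ` T)" Q
      by (rule V.span_is_submodule[OF bT])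
    have inT: "h p \<in> V.span (?b ` T)" if "Poly_Mapping.keys p \<subseteq> T" for p
      using that
    proof (induction p rule: poly_mapping_keys_induct)
      case zero
      show ?case using sp.zero_closed by (simp add: h0)
    next
      case (add q w c)
      have "?b w \<in> V.span (?b ` T)" using add V.in_own_span[OF bT] by blast
      then have "h q \<oplus>\<^bsub>Q\<^esub> c \<odot>\<^bsub>Q\<^esub> ?b w \<in> V.span (?b ` T)"
        using add sp.smult_closed[of c] by (intro sp.m_closed) auto
      then show ?case using add.hyps TS by (subst step) auto
    qed
    have "h p \<in> V.span (?b ` T)" if "Poly_Mapping.keys p \<subseteq> S" for p
      using that
    proof (induction p rule: poly_mapping_keys_induct)
      case zero
      show ?case using sp.zero_closed by (simp add: h0)
    next
      case (add q w c)
      have "?b w \<in> V.span (?b ` T)" using add span[of w] inT by metis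
      then have "h q \<oplus>\<^bsub>Q\<^esub> c \<odot>\<^bsub>Q\<^esub> ?b w \<in> V.span (?b ` T)"
        using add sp.smult_closed[of c] by (intro sp.m_closed) auto
      then show ?case using add.hyps by (subst step) auto
    qed
    then show "carrier Q \<subseteq> V.span (?b ` T)"
      by (subst onto) blast
  qed
  ultimately show "V.basis (?b ` T)"
    unfolding V.basis_def using bT by blast
qed

text \<open>Composing \<open>h\<close> with the projection modulo \<open>W\<close> turns the kernel
  and span conditions into membership in \<open>W\<close>. This serves both all words modulo the
  identities and multilinear words modulo the multilinear identities.\<close>

lemma quotient_linear_image_basis:
  fixes V :: "('k::field, 'a) module" and h :: "('i \<Rightarrow>\<^sub>0 'k) \<Rightarrow> 'a"
  assumes V: "vectorspace class_ring V" and W: "VectorSpace.subspace class_ring W V"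
    and onto: "carrier V = h ` {p. Poly_Mapping.keys p \<subseteq> S}"
    and add: "\<And>p q. Poly_Mapping.keys p \<subseteq> S \<Longrightarrow> Poly_Mapping.keys q \<subseteq> S \<Longrightarrow> h (p + q) = h p \<oplus>\<^bsub>V\<^esub> h q"
    and scale: "\<And>c p. Poly_Mapping.keys p \<subseteq> S \<Longrightarrow> h (pm_scale c p) = c \<odot>\<^bsub>V\<^esub> h p"
    and TS: "T \<subseteq> S"
    and ker: "\<And>p. Poly_Mapping.keys p \<subseteq> T \<Longrightarrow> h p \<in> W \<Longrightarrow> p = 0"
    and span: "\<And>w. w \<in> S \<Longrightarrow> \<exists>p. Poly_Mapping.keys p \<subseteq> T \<and> h (Poly_Mapping.single w 1 - p) \<in> W"
  shows "inj_on (\<lambda>w. W +>\<^bsub>V\<^esub> h (Poly_Mapping.single w 1)) T" (is ?inj)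
    and "vectorspace.basis class_ring (quotient_algebra V W) ((\<lambda>w. W +>\<^bsub>V\<^esub> h (Poly_Mapping.single w 1)) ` T)" (is ?basis)
proof -
  interpret V: vectorspace "class_ring :: 'k ring" V by fact
  interpret W: VectorSpace.subspace class_ring W V by fact
  interpret W: LinearCombinations.submodule class_ring W V by (rule W.submod)
  note q = coset_quotient[OF V W]
  have hc: "h p \<in> carrier V" if "Poly_Mapping.keys p \<subseteq> S" for p
    using that onto by blast
  have minus: "h (p - r) = h p \<ominus>\<^bsub>V\<^esub> h r" if "Poly_Mapping.keys p \<subseteq> S" "Poly_Mapping.keys r \<subseteq> S" for p r
  proof -
    have eq: "p - r = p + pm_scale (- 1) r"
      by (rule poly_mapping_eqI) (simp add: lookup_add lookup_minus)
    have "Poly_Mapping.keys (pm_scale (- 1) r) \<subseteq> S"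
      using that keys_pm_scale[of "- 1" r] by blast
    then have "h (p - r) = h p \<oplus>\<^bsub>V\<^esub> (- 1) \<odot>\<^bsub>V\<^esub> h r"
      unfolding eq using that add[of p "pm_scale (- 1) r"] scale[of r "- 1"] by simp
    also have "\<dots> = h p \<ominus>\<^bsub>V\<^esub> h r"
      using V.smult_minus_1[OF hc[OF that(2)]] by (simp add: a_minus_def class_ring_simps)
    finally show ?thesis .
  qed
  have zero: "\<zero>\<^bsub>quotient_algebra V W\<^esub> = W +>\<^bsub>V\<^esub> \<zero>\<^bsub>V\<^esub>"
    using V.M.a_coset_add_zero[of W] W.subset by (simp add: quotient_algebra_def)
  have car: "carrier (quotient_algebra V W) = (\<lambda>p. W +>\<^bsub>V\<^esub> h p) ` {p. Poly_Mapping.keys p \<subseteq> S}"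
    using q(2,6) onto by (auto simp: image_iff)
  let ?h = "\<lambda>p. W +>\<^bsub>V\<^esub> h p"
  have qadd: "?h (p + r) = ?h p \<oplus>\<^bsub>quotient_algebra V W\<^esub> ?h r"
    if "Poly_Mapping.keys p \<subseteq> S" "Poly_Mapping.keys r \<subseteq> S" for p r
    using that by (simp add: add q(3) hc)
  have qscale: "?h (pm_scale c p) = c \<odot>\<^bsub>quotient_algebra V W\<^esub> ?h p"
    if "Poly_Mapping.keys p \<subseteq> S" for c p
    using that by (simp add: scale q(4) hc)
  have qker: "p = 0" if p: "Poly_Mapping.keys p \<subseteq> T" and z: "?h p = \<zero>\<^bsub>quotient_algebra V W\<^esub>" for p
  proof -
    have k: "Poly_Mapping.keys p \<subseteq> S" using p TS by blast
    then have "h p \<ominus>\<^bsub>V\<^esub> \<zero>\<^bsub>V\<^esub> \<in> W" using z unfolding zero by (subst (asm) q(5)) (auto simp: hc)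
    moreover have "\<ominus>\<^bsub>V\<^esub> \<zero>\<^bsub>V\<^esub> = \<zero>\<^bsub>V\<^esub>" by (rule V.M.minus_equality) auto
    ultimately show ?thesis using p hc[OF k] by (intro ker) (auto simp: a_minus_def)
  qed
  have qspan: "\<exists>p. Poly_Mapping.keys p \<subseteq> T \<and> ?h (Poly_Mapping.single w 1) = ?h p" if w: "w \<in> S" for w
  proof -
    obtain p where p: "Poly_Mapping.keys p \<subseteq> T" "h (Poly_Mapping.single w 1 - p) \<in> W"
      using span[OF w] by blast
    have k: "Poly_Mapping.keys p \<subseteq> S" "Poly_Mapping.keys (Poly_Mapping.single w (1::'k)) \<subseteq> S" using p TS w by auto
    then have "?h (Poly_Mapping.single w 1) = ?h p"
      using p by (subst q(5)) (auto simp: hc minus)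
    then show ?thesis using p by blast
  qed
  show ?inj ?basis
    by (rule linear_image_basis[OF q(1) car qadd qscale TS qker qspan]; assumption)+
qed

section \<open>Evaluation of words\<close>

text \<open>Dedekind's argument: substituting \<open>f x y\<close> for \<open>x\<close> in the
  relation and subtracting \<open>\<chi> j y\<close> times the relation removes the term of
  \<open>j\<close>, so the induction hypothesis applies to the rest.\<close>

lemma monoid_characters_independent:
  fixes \<chi> :: "'i \<Rightarrow> 'm \<Rightarrow> 'k::field"
  assumes "finite F"
    and "\<And>i x y. i \<in> F \<Longrightarrow> \<chi> i (f x y) = \<chi> i x * \<chi> i y"
    and "\<And>i. i \<in> F \<Longrightarrow> \<exists>x. \<chi> i x \<noteq> 0"
    and "\<And>i j. i \<in> F \<Longrightarrow> j \<in> F \<Longrightarrow> \<chi> i = \<chi> j \<Longrightarrow> i = j"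
    and "\<And>x. (\<Sum>i\<in>F. a i * \<chi> i x) = 0"
    and "i \<in> F"
  shows "a i = 0"
  using assms
proof (induction F arbitrary: a i rule: finite_induct)
  case empty
  then show ?case by simp
next
  case (insert j F)
  note mult = insert.prems(1) and nz = insert.prems(2) and dist = insert.prems(3) and rel = insert.prems(4)
  have F: "a i = 0" if i: "i \<in> F" for i
  proof -
    obtain y where y: "\<chi> i y \<noteq> \<chi> j y"
      using dist[of i j] i insert.hyps(2) by (auto simp: fun_eq_iff)
    have "(\<Sum>i\<in>F. a i * (\<chi> i y - \<chi> j y) * \<chi> i x) = 0" for x
    proof -
      have "(\<Sum>i\<in>insert j F. a i * \<chi> i (f x y)) - \<chi> j y * (\<Sum>i\<in>insert j F. a i * \<chi> i x) =
          (\<Sum>i\<in>insert j F. a i * (\<chi> i y - \<chi> j y) * \<chi> i x)"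
        by (simp only: sum_distrib_left sum_subtractf[symmetric], rule sum.cong)
          (auto simp: mult algebra_simps)
      then show ?thesis
        using insert.hyps rel by simp
    qed
    then have "a i * (\<chi> i y - \<chi> j y) = 0"
      using mult nz dist i by (intro insert.IH[of "\<lambda>i. a i * (\<chi> i y - \<chi> j y)"]) auto
    then show ?thesis using y by simp
  qed
  obtain x where "\<chi> j x \<noteq> 0" using nz by blast
  moreover have "a j * \<chi> j x = 0"
    using rel[of x] insert.hyps F by simp
  ultimately show ?case using F insert.prems(5) by auto
qed

section \<open>Left-normed words and their values\<close>

definition lnword :: "nat \<Rightarrow> nat list \<Rightarrow> magma" where
  "lnword x ys = foldl (\<lambda>u y. Prod u (Var y)) (Var x) ys"

lemma lnword_Nil [simp]: "lnword x [] = Var x"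
  and lnword_snoc [simp]: "lnword x (ys @ [y]) = Prod (lnword x ys) (Var y)"
  by (simp_all add: lnword_def)

lemma letters_lnword [simp]: "letters (lnword x ys) = x # ys"
  by (induction ys rule: rev_induct) auto

text \<open>Passing to cosets is multiplicative, so a product of generators is the class of one
  word. This links the monomials of the statement with \<open>lnword\<close>.\<close>

lemma left_normed_gens:
  "left_normed free_leibniz (map gen (x # ys)) =
     leibniz_ideal +>\<^bsub>free_nonassoc\<^esub> Poly_Mapping.single (lnword x ys) (1 :: 'k::field)"
proof -
  interpret F: nonassoc_algebra "free_nonassoc :: ('k, magma \<Rightarrow>\<^sub>0 'k) module"
    by (rule nonassoc_algebra_free_nonassoc)
  note m = F.quotient_mult[OF algebra_ideal_leibniz_ideal, folded free_leibniz_def,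
      unfolded carrier_free_nonassoc, OF UNIV_I UNIV_I]
  have s: "Poly_Mapping.single u (1 :: 'k) \<otimes>\<^bsub>free_nonassoc\<^esub> Poly_Mapping.single v 1 =
      Poly_Mapping.single (Prod u v) 1" for u v
    unfolding free_nonassoc_def
    by (subst mult_table_algebra[of "{u}" _ "{v}"]) (auto simp: pm_scale_single)
  show ?thesis
    by (induction ys rule: rev_induct) (simp_all add: gen_def m s)
qed

lemma lookup_mult_L9:
  shows "Poly_Mapping.lookup (f \<otimes>\<^bsub>L9 \<alpha>\<^esub> g) E1 = \<alpha> * Poly_Mapping.lookup f E2 * Poly_Mapping.lookup g E3" (is ?E1)
    and "Poly_Mapping.lookup (f \<otimes>\<^bsub>L9 \<alpha>\<^esub> g) E2 = Poly_Mapping.lookup f E1 * Poly_Mapping.lookup g E3" (is ?E2)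
    and "Poly_Mapping.lookup (f \<otimes>\<^bsub>L9 \<alpha>\<^esub> g) E3 = 0" (is ?E3)
proof -
  have "Poly_Mapping.keys h \<subseteq> {E1, E2, E3}" for h :: "idx \<Rightarrow>\<^sub>0 'a"
    using idx.exhaust by auto
  then have "f \<otimes>\<^bsub>L9 \<alpha>\<^esub> g = (\<Sum>i\<in>{E1, E2, E3}. \<Sum>j\<in>{E1, E2, E3}.
      pm_scale (Poly_Mapping.lookup f i * Poly_Mapping.lookup g j) (L9_table \<alpha> i j))"
    unfolding L9_def by (intro mult_table_algebra) auto
  then show ?E1 ?E2 ?E3
    by (simp_all add: lookup_add lookup_single)
qed

lemma poly_mapping_idx_eqI:
  assumes "Poly_Mapping.lookup f E1 = Poly_Mapping.lookup g E1"
    "Poly_Mapping.lookup f E2 = Poly_Mapping.lookup g E2"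
    "Poly_Mapping.lookup f E3 = Poly_Mapping.lookup g E3"
  shows "f = g"
proof (rule poly_mapping_eqI)
  fix k show "Poly_Mapping.lookup f k = Poly_Mapping.lookup g k"
    using assms by (cases k) auto
qed

text \<open>Each further letter \<open>y\<close> swaps the first two coordinates and scales them by
  the \<open>E3\<close> coordinate of \<open>s y\<close>; passing from \<open>E2\<close> to
  \<open>E1\<close> costs a factor \<alpha>. This gives half the length, rounded up for
  \<open>E1\<close> and down for \<open>E2\<close>, as the exponent of \<alpha>.\<close>

lemma lookup_word_eval_lnword:
  shows "Poly_Mapping.lookup (word_eval (L9 \<alpha>) s (lnword x ys)) E1 =
      \<alpha> ^ ((length ys + 1) div 2) * Poly_Mapping.lookup (s x) (if even (length ys) then E1 else E2) *
      (\<Prod>y\<in>#mset ys. Poly_Mapping.lookup (s y) E3)" (is "?E1 ys")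
    and "Poly_Mapping.lookup (word_eval (L9 \<alpha>) s (lnword x ys)) E2 =
      \<alpha> ^ (length ys div 2) * Poly_Mapping.lookup (s x) (if even (length ys) then E2 else E1) *
      (\<Prod>y\<in>#mset ys. Poly_Mapping.lookup (s y) E3)" (is "?E2 ys")
    and "Poly_Mapping.lookup (word_eval (L9 \<alpha>) s (lnword x ys)) E3 =
      (if ys = [] then Poly_Mapping.lookup (s x) E3 else 0)" (is "?E3 ys")
proof -
  have "?E1 ys \<and> ?E2 ys"
    by (induction ys rule: rev_induct) (auto simp: lookup_mult_L9)
  then show "?E1 ys" "?E2 ys" by blast+
  show "?E3 ys"
    by (cases ys rule: rev_cases) (auto simp: lookup_mult_L9)
qed

text \<open>A product has \<open>E3\<close> coordinate zero and therefore gives zero as a right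
  factor; only words whose right factors are all letters can survive.\<close>

lemma lnword_or_zero:
  "(\<exists>x ys. w = lnword x ys) \<or> (\<forall>s. word_eval (L9 \<alpha>) s w = 0)"
proof (induction w)
  case (Var i)
  then show ?case by (metis lnword_Nil)
next
  case (Prod u v)
  show ?case
  proof (cases v)
    case (Var i)
    from Prod.IH(1) show ?thesis
    proof
      assume "\<exists>x ys. u = lnword x ys"
      then show ?thesis using Var lnword_snoc by metis
    qed (auto intro!: poly_mapping_idx_eqI simp: lookup_mult_L9)
  next
    case (Prod v1 v2)
    then show ?thesis
      by (auto intro!: poly_mapping_idx_eqI simp: lookup_mult_L9)
  qed
qed

lemma lookup_poly_eval_L9:
  "Poly_Mapping.lookup (poly_eval (L9 \<alpha>) s p) e =
     (\<Sum>w\<in>Poly_Mapping.keys p. Poly_Mapping.lookup p w * Poly_Mapping.lookup (word_eval (L9 \<alpha>) s w) e)"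
proof -
  interpret L: leibniz_algebra "L9 \<alpha>" by (rule leibniz_algebra_L9)
  have L9: "carrier (L9 \<alpha>) = UNIV" "\<zero>\<^bsub>L9 \<alpha>\<^esub> = 0" "x \<oplus>\<^bsub>L9 \<alpha>\<^esub> y = x + y" "c \<odot>\<^bsub>L9 \<alpha>\<^esub> x = pm_scale c x" for x y c
    by (simp_all add: L9_def)
  have "finsum (L9 \<alpha>) f F = sum f F" if "finite F" for f and F :: "magma set"
    using that
  proof (induction F rule: finite_induct)
    case empty
    show ?case using L.M.finsum_empty by (simp add: L9)
  next
    case (insert w F)
    then show ?case by (subst L.M.finsum_insert) (auto simp: L9)
  qed
  then show ?thesis
    unfolding poly_eval_def by (simp add: lookup_sum L9)
qed

text \<open>The monomial of the basis with first letter \<open>x\<close> and multiset \<open>\<mu>\<close> of remaining letters; thus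
  \<open>m\<^sub>1 = Suc (count \<mu> x)\<close>.\<close>

definition canonical_word :: "nat \<times> nat multiset \<Rightarrow> magma" where
  "canonical_word = (\<lambda>(x, \<mu>). lnword x (replicate (count \<mu> x) x @ sorted_list_of_multiset (filter_mset (\<lambda>y. y \<noteq> x) \<mu>)))"

lemma canonical_word_lnword: "\<exists>ys. canonical_word (x, \<mu>) = lnword x ys \<and> mset ys = \<mu>"
proof -
  have "mset (replicate (count \<mu> x) x @ sorted_list_of_multiset (filter_mset (\<lambda>y. y \<noteq> x) \<mu>)) = \<mu>"
    by (rule multiset_eqI) simp
  then show ?thesis unfolding canonical_word_def prod.case by blast
qed

lemma letters_canonical_word: "\<exists>ys. letters (canonical_word (x, \<mu>)) = x # ys \<and> mset ys = \<mu>"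
proof -
  obtain ys where "canonical_word (x, \<mu>) = lnword x ys" "mset ys = \<mu>" using canonical_word_lnword by blast
  then show ?thesis by (intro exI[of _ ys]) simp
qed

lemma inj_canonical_word: "inj canonical_word"
proof (rule injI, clarify)
  fix x \<mu> y \<nu> assume eq: "canonical_word (x, \<mu>) = canonical_word (y, \<nu>)"
  obtain ys where ys: "letters (canonical_word (x, \<mu>)) = x # ys" "mset ys = \<mu>" using letters_canonical_word by blast
  obtain zs where zs: "letters (canonical_word (y, \<nu>)) = y # zs" "mset zs = \<nu>" using letters_canonical_word by blast
  have "x # ys = y # zs" using ys(1) zs(1) eq by metis
  then show "x = y \<and> \<mu> = \<nu>" using ys(2) zs(2) by simp
qed

section \<open>Relatively free algebra and codimensions\<close>

text \<open>A substitution isolates the words with a fixed first letter and a fixed parity. Their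
  values are multiples of characters of the monoid of functions \<open>c\<close> under pointwise
  product, and \<open>dist\<close> makes these distinct. An abstract \<open>M\<close> covers all
  kinds of fields and the multilinear case.\<close>

lemma canonical_words_independent:
  fixes \<alpha> :: "'k::field"
  assumes "\<alpha> \<noteq> 0"
    and dist: "\<And>x \<mu> \<nu>. (x, \<mu>) \<in> M \<Longrightarrow> (x, \<nu>) \<in> M \<Longrightarrow> even (size \<mu>) = even (size \<nu>) \<Longrightarrow>
      (\<And>c :: nat \<Rightarrow> 'k. (\<Prod>y\<in>#\<mu>. c y) = (\<Prod>y\<in>#\<nu>. c y)) \<Longrightarrow> \<mu> = \<nu>"
    and p: "Poly_Mapping.keys p \<subseteq> canonical_word ` M"
    and zero: "\<And>s. poly_eval (L9 \<alpha>) s p = 0"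
  shows "p = 0"
proof (rule ccontr)
  assume "p \<noteq> 0"
  then obtain w where w: "w \<in> Poly_Mapping.keys p" by (metis keys_eq_empty ex_in_conv)
  then obtain x0 \<mu>0 where w0: "w = canonical_word (x0, \<mu>0)" "(x0, \<mu>0) \<in> M" using p by force
  define b where "b = even (size \<mu>0)"
  define G where "G = {\<mu>. canonical_word (x0, \<mu>) \<in> Poly_Mapping.keys p \<and> even (size \<mu>) = b}"
  \<comment> \<open>This includes the power of \<alpha> produced by the evaluation; as \<alpha> is
    not zero, \<open>coef\<close> vanishes only with the coefficient in \<open>p\<close>.\<close>
  define coef where "coef = (\<lambda>\<mu>. Poly_Mapping.lookup p (canonical_word (x0, \<mu>)) * \<alpha> ^ ((if b then size \<mu> + 1 else size \<mu>) div 2))"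
  define g where "g = (\<lambda>\<mu>. canonical_word (x0, \<mu>))"
  have gG: "g ` G \<subseteq> Poly_Mapping.keys p" by (auto simp: g_def G_def)
  have inj: "inj_on g G" using inj_canonical_word by (auto simp: g_def inj_on_def dest: injD)
  have G: "finite G"
    using finite_subset[OF gG] finite_imageD[OF _ inj] by simp
  have GM: "(x0, \<mu>) \<in> M" if "\<mu> \<in> G" for \<mu>
    using that p inj_canonical_word unfolding G_def by (auto dest!: injD[OF inj_canonical_word] subsetD)
  have rel: "(\<Sum>\<mu>\<in>G. coef \<mu> * (\<Prod>y\<in>#\<mu>. c y)) = 0" for c :: "nat \<Rightarrow> 'k"
  proof -
    \<comment> \<open>Only \<open>x0\<close> gets an \<open>E1\<close> component, no letter gets an
      \<open>E2\<close> component, and the \<open>E3\<close> coordinates are free. Starting from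
      \<open>E1\<close>, a word ends in \<open>E1\<close> or \<open>E2\<close> according to the
      parity of \<open>size \<mu>\<close>, so the coordinate \<open>e\<close> selects the parity
      \<open>b\<close>.\<close>
    define s where "s = (\<lambda>i. (if i = x0 then Poly_Mapping.single E1 1 else 0) + Poly_Mapping.single E3 (c i))"
    define e where "e = (if b then E1 else E2)"
    let ?t = "\<lambda>w. Poly_Mapping.lookup p w * Poly_Mapping.lookup (word_eval (L9 \<alpha>) s w) e"
    have s3: "Poly_Mapping.lookup (s i) E3 = c i" and s2: "Poly_Mapping.lookup (s i) E2 = 0"
      and s1: "Poly_Mapping.lookup (s i) E1 = (if i = x0 then 1 else 0)" for i
      by (simp_all add: s_def lookup_add lookup_single)
    have val: "Poly_Mapping.lookup (word_eval (L9 \<alpha>) s (canonical_word (x, \<mu>))) e =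
        (if x = x0 \<and> even (size \<mu>) = b
         then \<alpha> ^ ((if b then size \<mu> + 1 else size \<mu>) div 2) * (\<Prod>y\<in>#\<mu>. c y) else 0)" for x \<mu>
    proof -
      obtain ys where "canonical_word (x, \<mu>) = lnword x ys" "mset ys = \<mu>" using canonical_word_lnword by blast
      then show ?thesis
        by (cases b; cases "x = x0"; cases "even (size \<mu>)")
          (auto simp: e_def lookup_word_eval_lnword s1 s2 s3)
    qed
    have "0 = (\<Sum>w\<in>Poly_Mapping.keys p. ?t w)"
      using lookup_poly_eval_L9[of \<alpha> s p e] zero[of s] by simp
    also have "\<dots> = (\<Sum>w\<in>g ` G. ?t w)"
    proof (rule sum.mono_neutral_right[OF _ gG], simp, rule ballI)
      fix w assume w: "w \<in> Poly_Mapping.keys p - g ` G"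
      then obtain x \<mu> where x: "w = canonical_word (x, \<mu>)" using p by force
      then have "\<not> (x = x0 \<and> even (size \<mu>) = b)"
        using w by (auto simp: G_def g_def)
      then have "Poly_Mapping.lookup (word_eval (L9 \<alpha>) s w) e = 0"
        unfolding x val by (rule if_not_P)
      then show "?t w = 0" by simp
    qed
    also have "\<dots> = (\<Sum>\<mu>\<in>G. ?t (g \<mu>))"
      using inj by (simp add: sum.reindex)
    also have "\<dots> = (\<Sum>\<mu>\<in>G. coef \<mu> * (\<Prod>y\<in>#\<mu>. c y))"
      by (rule sum.cong) (simp_all add: g_def G_def val coef_def)
    finally show ?thesis by simp
  qed
  have "coef \<mu>0 = 0"
  proof (rule monoid_characters_independent[where f = "\<lambda>c d y. c y * d y", OF G _ _ _ rel])
    show "\<mu>0 \<in> G" using w w0 by (simp add: G_def b_def)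
    show "(\<Prod>y\<in>#\<mu>. c y * d y) = (\<Prod>y\<in>#\<mu>. c y) * (\<Prod>y\<in>#\<mu>. d y :: 'k)" for \<mu> c d
      by (rule prod_mset.distrib)
    show "\<exists>c. (\<Prod>y\<in>#\<mu>. c y :: 'k) \<noteq> 0" for \<mu>
      by (rule exI[of _ "\<lambda>_. 1"]) simp
    show "\<mu> = \<nu>" if "\<mu> \<in> G" "\<nu> \<in> G" "(\<lambda>c. \<Prod>y\<in>#\<mu>. c y :: 'k) = (\<lambda>c. \<Prod>y\<in>#\<nu>. c y)" for \<mu> \<nu>
      using that dist[OF GM[OF that(1)] GM[OF that(2)]] by (auto simp: G_def dest: fun_cong)
  qed
  then show False
    using w w0 assms(1) by (simp add: coef_def in_keys_iff)
qed

text \<open>Words with the same first letter, parity and product function have proportional first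
  two coordinates. Emptiness of the multiset must also agree, because the \<open>E3\<close>
  coordinate survives only for a single letter. Asking for a reduction of \<open>w\<close> alone
  allows the use on multilinear words.\<close>

lemma word_reduces:
  fixes \<alpha> :: "'k::field"
  assumes "\<alpha> \<noteq> 0"
    and red: "\<And>x ys. w = lnword x ys \<Longrightarrow> \<exists>\<nu>. (x, \<nu>) \<in> M \<and> even (size \<nu>) = even (length ys) \<and>
      (\<nu> = {#} \<longleftrightarrow> ys = []) \<and> (\<forall>c :: nat \<Rightarrow> 'k. (\<Prod>y\<in>#mset ys. c y) = (\<Prod>y\<in>#\<nu>. c y))"
  shows "\<exists>p. Poly_Mapping.keys p \<subseteq> canonical_word ` M \<and> (\<forall>s. poly_eval (L9 \<alpha>) s (Poly_Mapping.single w 1 - p) = 0)"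
proof -
  interpret L: leibniz_algebra "L9 \<alpha>" by (rule leibniz_algebra_L9)
  have L9: "carrier (L9 \<alpha>) = UNIV" "x \<ominus>\<^bsub>L9 \<alpha>\<^esub> y = x - y" "c \<odot>\<^bsub>L9 \<alpha>\<^esub> x = pm_scale c x" for x y c
    by (simp_all add: L9_def)
  have ev: "poly_eval (L9 \<alpha>) s (Poly_Mapping.single w 1 - Poly_Mapping.single v c) =
      word_eval (L9 \<alpha>) s w - pm_scale c (word_eval (L9 \<alpha>) s v)" for s v c
  proof -
    have s: "range s \<subseteq> carrier (L9 \<alpha>)" by (simp add: L9)
    show ?thesis
      by (simp only: L.poly_eval_minus[OF s] L.poly_eval_single[OF s] L9)
        (auto intro: poly_mapping_eqI)
  qed
  show ?thesis
  proof (cases "\<exists>x ys. w = lnword x ys")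
    case False
    then have "\<forall>s. word_eval (L9 \<alpha>) s w = 0" using lnword_or_zero by blast
    then have "\<forall>s. poly_eval (L9 \<alpha>) s (Poly_Mapping.single w 1 - Poly_Mapping.single w 0) = 0"
      unfolding ev by (auto intro: poly_mapping_eqI)
    then show ?thesis by (intro exI[of _ 0]) simp
  next
    case True
    then obtain x ys where w: "w = lnword x ys" by blast
    obtain \<nu> where \<nu>: "(x, \<nu>) \<in> M" "even (size \<nu>) = even (length ys)" "\<nu> = {#} \<longleftrightarrow> ys = []"
      and c: "\<And>c :: nat \<Rightarrow> 'k. (\<Prod>y\<in>#mset ys. c y) = (\<Prod>y\<in>#\<nu>. c y)" using red[OF w] by blast
    obtain zs where zs: "canonical_word (x, \<nu>) = lnword x zs" "mset zs = \<nu>" using canonical_word_lnword by blast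
    have par: "even (length zs) = even (length ys)" using \<nu>(2) zs(2) size_mset by metis
    have emp: "zs = [] \<longleftrightarrow> ys = []" using \<nu>(3) zs(2) by auto
    have pr: "(\<Prod>y\<in>#mset zs. c y) = (\<Prod>y\<in>#mset ys. c y)" for c :: "nat \<Rightarrow> 'k"
      using c zs(2) by simp
    \<comment> \<open>The ratio of the powers of \<alpha> in the two values. Equal parity of the
      lengths makes the same ratio work for the rounded-up exponents in \<open>d1\<close>; for a
      single letter it is 1, as the \<open>E3\<close> coordinate requires.\<close>
    define d where "d = \<alpha> ^ (length ys div 2) / \<alpha> ^ (length zs div 2)"
    have d0: "d * \<alpha> ^ (length zs div 2) = \<alpha> ^ (length ys div 2)"
      using assms(1) by (simp add: d_def)
    have half: "\<alpha> ^ ((n + 1) div 2) = \<alpha> ^ (n div 2) * (if even n then 1 else \<alpha>)" for n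
      by auto
    have d1: "d * \<alpha> ^ ((length zs + 1) div 2) = \<alpha> ^ ((length ys + 1) div 2)"
      unfolding half mult.assoc[symmetric] d0 par ..
    have dn: "d = 1" if "ys = []" using that emp by (simp add: d_def)
    have "word_eval (L9 \<alpha>) s w = pm_scale d (word_eval (L9 \<alpha>) s (canonical_word (x, \<nu>)))" for s
      unfolding w zs(1)
      by (rule poly_mapping_idx_eqI)
        (simp_all only: lookup_word_eval_lnword lookup_pm_scale mult.assoc[symmetric] d0 d1 par pr emp,
         simp add: dn)
    then have "\<forall>s. poly_eval (L9 \<alpha>) s (Poly_Mapping.single w 1 - Poly_Mapping.single (canonical_word (x, \<nu>)) d) = 0"
      unfolding ev by simp
    moreover have "Poly_Mapping.keys (Poly_Mapping.single (canonical_word (x, \<nu>)) d) \<subseteq> canonical_word ` M"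
      using \<nu>(1) by auto
    ultimately show ?thesis by blast
  qed
qed

section \<open>Bases of the relatively free algebra\<close>

lemma free_leibniz_coset:
  shows "carrier free_leibniz = range (\<lambda>p. leibniz_ideal +>\<^bsub>free_nonassoc\<^esub> (p :: magma \<Rightarrow>\<^sub>0 'k::field))"
    and "leibniz_ideal +>\<^bsub>free_nonassoc\<^esub> (p + q) =
      (leibniz_ideal +>\<^bsub>free_nonassoc\<^esub> p) \<oplus>\<^bsub>free_leibniz\<^esub> (leibniz_ideal +>\<^bsub>free_nonassoc\<^esub> (q :: magma \<Rightarrow>\<^sub>0 'k))"
    and "leibniz_ideal +>\<^bsub>free_nonassoc\<^esub> (pm_scale c p) =
      c \<odot>\<^bsub>free_leibniz\<^esub> (leibniz_ideal +>\<^bsub>free_nonassoc\<^esub> p)"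
proof -
  interpret F: nonassoc_algebra "free_nonassoc :: ('k, magma \<Rightarrow>\<^sub>0 'k) module"
    by (rule nonassoc_algebra_free_nonassoc)
  have "VectorSpace.subspace class_ring leibniz_ideal (free_nonassoc :: ('k, magma \<Rightarrow>\<^sub>0 'k) module)"
    using algebra_ideal_leibniz_ideal[where ?'a = 'k] unfolding algebra_ideal_def by blast
  note q = coset_quotient[OF F.vectorspace_axioms this, folded free_leibniz_def]
  show "carrier free_leibniz = range (\<lambda>p. leibniz_ideal +>\<^bsub>free_nonassoc\<^esub> (p :: magma \<Rightarrow>\<^sub>0 'k))"
    using q(2)[unfolded carrier_free_nonassoc, OF UNIV_I] q(6) by blast
  show "leibniz_ideal +>\<^bsub>free_nonassoc\<^esub> (p + q) =
      (leibniz_ideal +>\<^bsub>free_nonassoc\<^esub> p) \<oplus>\<^bsub>free_leibniz\<^esub> (leibniz_ideal +>\<^bsub>free_nonassoc\<^esub> q)"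
    using q(3)[of p q] by simp
  show "leibniz_ideal +>\<^bsub>free_nonassoc\<^esub> (pm_scale c p) =
      c \<odot>\<^bsub>free_leibniz\<^esub> (leibniz_ideal +>\<^bsub>free_nonassoc\<^esub> p)"
    using q(4)[of p c] by simp
qed

lemma coset_in_identities_L9_iff:
  "leibniz_ideal +>\<^bsub>free_nonassoc\<^esub> p \<in> identities (L9 \<alpha>) \<longleftrightarrow> (\<forall>s. poly_eval (L9 \<alpha>) s p = 0)"
  using leibniz_algebra.coset_in_identities_iff[OF leibniz_algebra_L9] by (simp add: L9_def)

text \<open>Reduces the basis claims to exponents: for each first letter, \<open>M\<close> must
  represent every class of multisets with the same parity, emptiness and product function exactly
  once; \<open>dist\<close> gives at most one representative and \<open>red\<close> at least
  one.\<close>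

lemma images_form_basis_L9:
  fixes \<alpha> :: "'k::field"
  assumes "\<alpha> \<noteq> 0"
    and dist: "\<And>x \<mu> \<nu>. (x, \<mu>) \<in> M \<Longrightarrow> (x, \<nu>) \<in> M \<Longrightarrow> even (size \<mu>) = even (size \<nu>) \<Longrightarrow>
      (\<And>c :: nat \<Rightarrow> 'k. (\<Prod>y\<in>#\<mu>. c y) = (\<Prod>y\<in>#\<nu>. c y)) \<Longrightarrow> \<mu> = \<nu>"
    and red: "\<And>x \<mu>. \<exists>\<nu>. (x, \<nu>) \<in> M \<and> even (size \<nu>) = even (size \<mu>) \<and>
      (\<nu> = {#} \<longleftrightarrow> \<mu> = {#}) \<and> (\<forall>c :: nat \<Rightarrow> 'k. (\<Prod>y\<in>#\<mu>. c y) = (\<Prod>y\<in>#\<nu>. c y))"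
  shows "images_form_basis (L9 \<alpha>)
    ((\<lambda>w. leibniz_ideal +>\<^bsub>free_nonassoc\<^esub> Poly_Mapping.single w 1) ` canonical_word ` M)"
proof -
  interpret L: leibniz_algebra "L9 \<alpha>" by (rule leibniz_algebra_L9)
  interpret FL: leibniz_algebra "free_leibniz :: ('k, (magma \<Rightarrow>\<^sub>0 'k) set) module"
    by (rule leibniz_algebra_free_leibniz)
  have sub: "VectorSpace.subspace class_ring (identities (L9 \<alpha>)) free_leibniz"
    using L.algebra_ideal_identities by (simp add: algebra_ideal_def)
  have ker: "p = 0" if "Poly_Mapping.keys p \<subseteq> canonical_word ` M"
    "leibniz_ideal +>\<^bsub>free_nonassoc\<^esub> p \<in> identities (L9 \<alpha>)" for p
    using that(2) unfolding coset_in_identities_L9_iff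
    by (intro canonical_words_independent[OF assms(1) dist that(1)]) blast+
  have span: "\<exists>p. Poly_Mapping.keys p \<subseteq> canonical_word ` M \<and>
    leibniz_ideal +>\<^bsub>free_nonassoc\<^esub> (Poly_Mapping.single w 1 - p) \<in> identities (L9 \<alpha>)" for w
    unfolding coset_in_identities_L9_iff
  proof (rule word_reduces[OF assms(1)])
    fix x ys
    show "\<exists>\<nu>. (x, \<nu>) \<in> M \<and> even (size \<nu>) = even (length ys) \<and>
      (\<nu> = {#} \<longleftrightarrow> ys = []) \<and> (\<forall>c :: nat \<Rightarrow> 'k. (\<Prod>y\<in>#mset ys. c y) = (\<Prod>y\<in>#\<nu>. c y))"
      using red[of x "mset ys"] by simp
  qed
  have car: "carrier free_leibniz =
      (\<lambda>p. leibniz_ideal +>\<^bsub>free_nonassoc\<^esub> p) ` {p :: magma \<Rightarrow>\<^sub>0 'k. Poly_Mapping.keys p \<subseteq> UNIV}"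
    using free_leibniz_coset(1) by simp
  note b = quotient_linear_image_basis[OF FL.vectorspace_axioms sub car free_leibniz_coset(2,3) subset_UNIV ker span]
  show ?thesis
    unfolding images_form_basis_def relatively_free_def image_comp
  proof
    show "inj_on (\<lambda>f. identities (L9 \<alpha>) +>\<^bsub>free_leibniz\<^esub> f)
      (((\<lambda>w. leibniz_ideal +>\<^bsub>free_nonassoc\<^esub> Poly_Mapping.single w 1) \<circ> canonical_word) ` M)"
      unfolding image_comp[symmetric] by (rule inj_on_imageI) (use b(1) in \<open>simp add: o_def\<close>)
    show "vectorspace.basis class_ring (quotient_algebra free_leibniz (identities (L9 \<alpha>)))
     (((\<lambda>f. identities (L9 \<alpha>) +>\<^bsub>free_leibniz\<^esub> f) \<circ>
       ((\<lambda>w. leibniz_ideal +>\<^bsub>free_nonassoc\<^esub> Poly_Mapping.single w 1) \<circ> canonical_word)) ` M)"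
      using b(2) by (simp add: image_comp o_def)
  qed
qed

section \<open>Multilinear elements and codimensions\<close>

lemma subspace_multilinear:
  "VectorSpace.subspace class_ring (multilinear n) (free_leibniz :: ('k::field, (magma \<Rightarrow>\<^sub>0 'k) set) module)"
proof -
  interpret FL: leibniz_algebra "free_leibniz :: ('k, (magma \<Rightarrow>\<^sub>0 'k) set) module"
    by (rule leibniz_algebra_free_leibniz)
  let ?P = "\<lambda>p :: magma \<Rightarrow>\<^sub>0 'k. \<forall>w\<in>Poly_Mapping.keys p. distinct (letters w) \<and> set (letters w) = {..<n}"
  let ?h = "\<lambda>p :: magma \<Rightarrow>\<^sub>0 'k. leibniz_ideal +>\<^bsub>free_nonassoc\<^esub> p"
  have z: "\<zero>\<^bsub>free_leibniz\<^esub> = ?h 0"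
    unfolding free_leibniz_def quotient_algebra_def a_r_coset_def' ring.simps add_free_nonassoc
    by (simp only: add_0_right UN_singleton)
  show ?thesis
  proof (intro VectorSpace.subspace.intro LinearCombinations.submodule.intro FL.vectorspace_axioms FL.module_axioms)
    show "(multilinear n :: (magma \<Rightarrow>\<^sub>0 'k) set set) \<subseteq> carrier free_leibniz"
      unfolding multilinear_def free_leibniz_coset(1) by blast
    show "\<zero>\<^bsub>free_leibniz\<^esub> \<in> (multilinear n :: (magma \<Rightarrow>\<^sub>0 'k) set set)"
      unfolding multilinear_def z by force
    fix X Y :: "(magma \<Rightarrow>\<^sub>0 'k) set" assume "X \<in> multilinear n"
    then obtain p where p: "X = ?h p" "?P p" unfolding multilinear_def by blast
    have "?P (pm_scale c p)" for c using p(2) keys_pm_scale[of c p] by blast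
    then show "c \<odot>\<^bsub>free_leibniz\<^esub> X \<in> multilinear n" for c
      unfolding p(1) free_leibniz_coset(3)[symmetric] multilinear_def by blast
    assume "Y \<in> multilinear n"
    then obtain r where r: "Y = ?h r" "?P r" unfolding multilinear_def by blast
    have "?P (p + r)" using p(2) r(2) keys_add[of p r] by blast
    then show "X \<oplus>\<^bsub>free_leibniz\<^esub> Y \<in> multilinear n"
      unfolding p(1) r(1) free_leibniz_coset(2)[symmetric] multilinear_def by blast
  qed
qed

text \<open>In a multilinear word the first letter determines the multiset of the others and hence
  the parity. So there is one canonical representative per first letter, over every field.\<close>

lemma codimension_L9:
  fixes \<alpha> :: "'k::field"
  assumes "\<alpha> \<noteq> 0"
  shows "codimension (L9 \<alpha>) n = n"
proof -
  interpret L: leibniz_algebra "L9 \<alpha>" by (rule leibniz_algebra_L9)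
  interpret FL: leibniz_algebra "free_leibniz :: ('k, (magma \<Rightarrow>\<^sub>0 'k) set) module"
    by (rule leibniz_algebra_free_leibniz)
  let ?V = "free_leibniz\<lparr>carrier := multilinear n\<rparr> :: ('k, (magma \<Rightarrow>\<^sub>0 'k) set) module"
  let ?W = "multilinear n \<inter> identities (L9 \<alpha>)"
  let ?h = "\<lambda>p :: magma \<Rightarrow>\<^sub>0 'k. leibniz_ideal +>\<^bsub>free_nonassoc\<^esub> p"
  define S where "S = {w. distinct (letters w) \<and> set (letters w) = {..<n}}"
  define M where "M = (\<lambda>x. (x, mset_set ({..<n} - {x}))) ` {..<n}"
  have V: "vectorspace class_ring ?V"
    by (rule FL.subspace_is_vs[OF subspace_multilinear])
  have car: "carrier ?V = ?h ` {p. Poly_Mapping.keys p \<subseteq> S}"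
    by (auto simp: multilinear_def S_def)
  have sub: "VectorSpace.subspace class_ring ?W ?V"
  proof -
    interpret I: VectorSpace.subspace class_ring "identities (L9 \<alpha>)" free_leibniz
      using L.algebra_ideal_identities by (simp add: algebra_ideal_def)
    interpret I: LinearCombinations.submodule class_ring "identities (L9 \<alpha>)" free_leibniz by (rule I.submod)
    interpret N: VectorSpace.subspace class_ring "multilinear n" "free_leibniz :: ('k, (magma \<Rightarrow>\<^sub>0 'k) set) module"
      by (rule subspace_multilinear)
    interpret N: LinearCombinations.submodule class_ring "multilinear n" "free_leibniz :: ('k, (magma \<Rightarrow>\<^sub>0 'k) set) module" by (rule N.submod)
    show ?thesis
      using I.zero_closed N.zero_closed I.m_closed N.m_closed I.smult_closed N.smult_closed V
      by (intro VectorSpace.subspace.intro LinearCombinations.submodule.intro V vectorspace.axioms(1)[OF V]) auto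
  qed
  have cS: "canonical_word ` M \<subseteq> S"
  proof
    fix w assume "w \<in> canonical_word ` M"
    then obtain x where x: "x < n" "w = canonical_word (x, mset_set ({..<n} - {x}))" by (auto simp: M_def)
    obtain ys where ys: "letters w = x # ys" "mset ys = mset_set ({..<n} - {x})"
      using letters_canonical_word[of x] x by blast
    have st: "set ys = {..<n} - {x}" using ys(2) by (metis finite_Diff finite_lessThan finite_set_mset_mset_set set_mset_mset)
    have "length ys = card ({..<n} - {x})" using ys(2) by (metis size_mset size_mset_set)
    then have "distinct ys" using st by (intro card_distinct) simp
    then show "w \<in> S" using x ys st by (auto simp: S_def)
  qed
  have hS: "?h p \<in> multilinear n" if "Poly_Mapping.keys p \<subseteq> S" for p
    using that by (auto simp: multilinear_def S_def)
  have ker: "p = 0" if "Poly_Mapping.keys p \<subseteq> canonical_word ` M" "?h p \<in> ?W" for p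
    using that(2) unfolding coset_in_identities_L9_iff Int_iff
    by (intro canonical_words_independent[OF assms _ that(1)]) (auto simp: M_def)
  have span: "\<exists>p. Poly_Mapping.keys p \<subseteq> canonical_word ` M \<and> ?h (Poly_Mapping.single w 1 - p) \<in> ?W" if w: "w \<in> S" for w
  proof -
    have "\<exists>p. Poly_Mapping.keys p \<subseteq> canonical_word ` M \<and> (\<forall>s. poly_eval (L9 \<alpha>) s (Poly_Mapping.single w 1 - p) = 0)"
    proof (rule word_reduces[OF assms])
      fix x ys assume "w = lnword x ys"
      then have d: "distinct (x # ys)" "set (x # ys) = {..<n}" using w by (auto simp: S_def)
      then have "set ys = {..<n} - {x}" "x < n" by auto
      then have "mset ys = mset_set ({..<n} - {x})" using d by (metis distinct.simps(2) mset_set_set)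
      then have "(x, mset ys) \<in> M" using \<open>x < n\<close> by (simp add: M_def)
      then show "\<exists>\<nu>. (x, \<nu>) \<in> M \<and> even (size \<nu>) = even (length ys) \<and> (\<nu> = {#} \<longleftrightarrow> ys = []) \<and>
          (\<forall>c :: nat \<Rightarrow> 'k. (\<Prod>y\<in>#mset ys. c y) = (\<Prod>y\<in>#\<nu>. c y))"
        by (intro exI[of _ "mset ys"]) simp
    qed
    then obtain p where p: "Poly_Mapping.keys p \<subseteq> canonical_word ` M"
      "\<forall>s. poly_eval (L9 \<alpha>) s (Poly_Mapping.single w 1 - p) = 0" by blast
    \<comment> \<open>Membership in \<open>?W\<close> also requires the difference to be
      multilinear.\<close>
    have "Poly_Mapping.keys (Poly_Mapping.single w 1 - p) \<subseteq> S"
      using p(1) cS w keys_diff[of "Poly_Mapping.single w 1" p] by auto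
    then show ?thesis
      using p hS coset_in_identities_L9_iff by blast
  qed
  have add: "?h (p + q) = ?h p \<oplus>\<^bsub>?V\<^esub> ?h q" and scale: "?h (pm_scale c p) = c \<odot>\<^bsub>?V\<^esub> ?h p" for p q c
    by (simp_all add: free_leibniz_coset)
  note b = quotient_linear_image_basis[OF V sub car add scale cS ker span]
  have "card M = n" unfolding M_def by (subst card_image) (auto simp: inj_on_def)
  then have "card (canonical_word ` M) = n" using inj_canonical_word by (metis card_image inj_on_subset subset_UNIV)
  moreover have fin: "finite (canonical_word ` M)" by (simp add: M_def)
  moreover have "vectorspace class_ring (quotient_algebra ?V ?W)" by (rule coset_quotient(1)[OF V sub])
  ultimately show ?thesis
    unfolding codimension_def using b card_image[OF b(1)]
    by (subst vectorspace.dim_basis[OF _ finite_imageI[OF fin] b(2)]) auto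
qed

section \<open>Reduction of exponents\<close>

text \<open>Setting all variables but one to 1 isolates a single exponent; conversely each product
  factors into powers over the union of the two supports.\<close>

lemma monomials_eq_iff:
  "(\<forall>c :: nat \<Rightarrow> 'k::field. (\<Prod>y\<in>#\<mu>. c y) = (\<Prod>y\<in>#\<nu>. c y)) \<longleftrightarrow>
     (\<forall>j (t :: 'k). t ^ count \<mu> j = t ^ count \<nu> j)"
proof -
  let ?S = "set_mset \<mu> \<union> set_mset \<nu>"
  have eq: "(\<Prod>y\<in>#\<rho>. c y) = (\<Prod>y\<in>S. c y ^ count \<rho> y)"
    if "finite S" "set_mset \<rho> \<subseteq> S" for \<rho> S and c :: "nat \<Rightarrow> 'k"
    unfolding image_prod_mset_multiplicity using that
    by (intro prod.mono_neutral_left) (auto simp: not_in_iff)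
  have single: "(\<Prod>y\<in>#\<rho>. if y = j then t else 1) = t ^ count \<rho> j" for \<rho> j and t :: 'k
    by (induction \<rho>) auto
  show ?thesis
  proof (intro iffI allI)
    fix j and t :: 'k
    assume "\<forall>c :: nat \<Rightarrow> 'k. (\<Prod>y\<in>#\<mu>. c y) = (\<Prod>y\<in>#\<nu>. c y)"
    then have "(\<Prod>y\<in>#\<mu>. if y = j then t else 1) = (\<Prod>y\<in>#\<nu>. if y = j then t else 1)" by blast
    then show "t ^ count \<mu> j = t ^ count \<nu> j" by (simp only: single)
  next
    fix c :: "nat \<Rightarrow> 'k"
    assume "\<forall>j (t :: 'k). t ^ count \<mu> j = t ^ count \<nu> j"
    then show "(\<Prod>y\<in>#\<mu>. c y) = (\<Prod>y\<in>#\<nu>. c y)"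
      using eq[of ?S \<mu> c] eq[of ?S \<nu> c] by simp
  qed
qed

text \<open>Every element of the field is a root of the nonzero polynomial X^m - X^n, whose degree
  is at most \<open>max m n\<close>.\<close>

lemma power_eq_on_field:
  assumes "\<And>t :: 'k::field. t ^ m = t ^ n" and "m \<noteq> n"
  shows "finite (UNIV :: 'k set)" and "CARD('k) \<le> max m n"
proof -
  let ?p = "Polynomial.monom 1 m - Polynomial.monom 1 n :: 'k poly"
  have "coeff ?p m = 1" using assms(2) by (simp add: coeff_diff)
  then have p: "?p \<noteq> 0" by (metis coeff_0 zero_neq_one)
  have roots: "{t. poly ?p t = 0} = UNIV" using assms(1) by (auto simp: poly_monom)
  show "finite (UNIV :: 'k set)" using poly_roots_finite[OF p] roots by simp
  have "CARD('k) \<le> degree ?p" using card_poly_roots_bound[OF p] roots by simp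
  also have "\<dots> \<le> max m n"
    by (rule degree_diff_le) (auto intro: order.trans[OF degree_monom_le])
  finally show "CARD('k) \<le> max m n" .
qed

text \<open>Multiplication by a nonzero \<open>t\<close> permutes the nonzero elements; comparing
  their products gives \<open>t ^ (CARD('k) - 1) = 1\<close>.\<close>

lemma power_card_field:
  fixes t :: "'k::field"
  assumes "finite (UNIV :: 'k set)"
  shows "t ^ CARD('k) = t"
proof (cases "t = 0")
  case True
  then show ?thesis using assms by (simp add: zero_power finite_UNIV_card_ge_0)
next
  case False
  let ?U = "UNIV - {0 :: 'k}"
  have "prod id ?U = (\<Prod>y\<in>?U. t * y)"
    using False by (intro prod.reindex_bij_witness[of _ "\<lambda>y. t * y" "\<lambda>y. y / t"]) auto
  also have "\<dots> = t ^ (CARD('k) - 1) * prod id ?U"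
    using assms by (simp add: prod.distrib card_Diff_singleton)
  finally have "t ^ (CARD('k) - 1) = 1"
    using assms by (simp add: prod_zero_iff)
  moreover have "CARD('k) = Suc (CARD('k) - 1)"
    using assms finite_UNIV_card_ge_0 by force
  ultimately show ?thesis by (metis mult.right_neutral power_Suc)
qed

lemma card_field_ge_2:
  assumes "finite (UNIV :: 'k::field set)"
  shows "2 \<le> CARD('k)"
  using card_mono[OF assms, of "{0, 1}"] by simp

text \<open>The least exponent defining the same function on a field with \<open>q\<close> elements.\<close>

definition reduce :: "nat \<Rightarrow> nat \<Rightarrow> nat" where
  "reduce q m = (if m = 0 then 0 else 1 + (m - 1) mod (q - 1))"

lemma reduce_le:
  assumes "2 \<le> q"
  shows "reduce q m < q"
proof -
  have "(m - 1) mod (q - 1) < q - 1" using assms by (intro mod_less_divisor) simp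
  then show ?thesis by (auto simp: reduce_def)
qed

lemma reduce_eq_0_iff [simp]: "reduce q m = 0 \<longleftrightarrow> m = 0"
  by (simp add: reduce_def)

lemma reduce_pos_iff [simp]: "0 < reduce q m \<longleftrightarrow> 0 < m"
  by (simp add: reduce_def)

text \<open>The modulus \<open>q - 1\<close> is even, so taking remainders keeps parity, and the two
  shifts by 1 cancel.\<close>

lemma reduce_odd: "odd q \<Longrightarrow> even (reduce q m) = even m"
  by (auto simp: reduce_def dvd_mod_iff elim!: oddE)

text \<open>Iterates t^q = t. The exponent is written \<open>Suc r\<close> because t = 0 separates
  exponent 0 from the positive ones.\<close>

lemma power_reduce:
  fixes t :: "'k::field"
  assumes "finite (UNIV :: 'k set)"
  shows "t ^ (Suc r + (CARD('k) - 1) * k) = t ^ Suc r" and "t ^ reduce CARD('k) m = t ^ m"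
proof -
  let ?q = "CARD('k)"
  have q: "2 \<le> ?q" using assms by (rule card_field_ge_2)
  then obtain p where p: "?q = Suc p" by (cases ?q) auto
  have *: "t ^ (Suc r + (?q - 1) * k) = t ^ Suc r" for r k
  proof (induction k)
    case (Suc k)
    have "Suc r + (?q - 1) * Suc k = (r + (?q - 1) * k) + ?q" by (simp add: p)
    then have "t ^ (Suc r + (?q - 1) * Suc k) = t ^ (r + (?q - 1) * k) * t"
      by (simp only: power_add power_card_field[OF assms])
    also have "\<dots> = t ^ Suc r" using Suc by (simp add: mult.commute)
    finally show ?case .
  qed simp
  show "t ^ (Suc r + (?q - 1) * k) = t ^ Suc r" by (rule *)
  show "t ^ reduce ?q m = t ^ m"
  proof (cases m)
    case (Suc r)
    have "m = Suc (r mod (?q - 1)) + (?q - 1) * (r div (?q - 1))"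
      using Suc by simp
    then have "t ^ m = t ^ Suc (r mod (?q - 1))" by (metis *)
    then show ?thesis using Suc by (auto simp: reduce_def)
  qed (simp add: reduce_def)
qed

text \<open>Reduced exponents lie below q, while of two distinct exponents with the same function
  one is at least q.\<close>

lemma reduce_eq_if_powers_eq:
  assumes "finite (UNIV :: 'k::field set)" and "\<And>t :: 'k. t ^ m = t ^ n"
  shows "reduce CARD('k) m = reduce CARD('k) n"
proof (rule ccontr)
  assume "reduce CARD('k) m \<noteq> reduce CARD('k) n"
  then have "CARD('k) \<le> max (reduce CARD('k) m) (reduce CARD('k) n)"
    using assms(2) by (intro power_eq_on_field(2)) (auto simp: power_reduce[OF assms(1)])
  then show False using reduce_le[OF card_field_ge_2[OF assms(1)], of m] reduce_le[OF card_field_ge_2[OF assms(1)], of n] by simp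
qed

lemma reduce_id: "m < q \<Longrightarrow> reduce q m = m"
  by (auto simp: reduce_def)

text \<open>Equal reductions force a difference divisible by the odd number q - 1. Two positive
  exponents below \<open>2 * q - 1\<close> can then differ only by 0 or q - 1, and the latter
  changes parity.\<close>

lemma reduce_parity_inj:
  assumes "even q" "reduce q m = reduce q n" "even m = even n" "m < 2 * q - 1" "n < 2 * q - 1"
  shows "m = n"
proof -
  have *: "m = n" if "m \<le> n" "reduce q m = reduce q n" "even m = even n" "n < 2 * q - 1" for m n
  proof (cases m)
    case 0
    then show ?thesis using that(2) reduce_eq_0_iff by metis
  next
    case (Suc r)
    then have "(m - 1) mod (q - 1) = (n - 1) mod (q - 1)" using that by (auto simp: reduce_def)
    then have "(q - 1) dvd (n - 1) - (m - 1)"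
      using that(1) Suc by (subst mod_eq_dvd_iff_nat[symmetric]) auto
    then obtain k where k: "n - m = (q - 1) * k" using that(1) Suc by (auto elim!: dvdE)
    have "(q - 1) * k < (q - 1) * 2" using k that Suc by linarith
    then have "k = 0 \<or> k = 1" by (auto simp: less_2_cases_iff)
    moreover have "k \<noteq> 1"
    proof
      assume "k = 1"
      \<comment> \<open>The strict inequality excludes q = 0, where truncated subtraction would make
        q - 1 even.\<close>
      then have "odd (n - m)" using k assms(1) \<open>(q - 1) * k < (q - 1) * 2\<close> by auto
      then show False using that by auto
    qed
    ultimately show ?thesis using k that(1) by simp
  qed
  show ?thesis
    using *[of m n] *[of n m] assms by (cases "m \<le> n") auto
qed

lemma even_size_cong:
  assumes "\<And>j. even (count \<mu> j) = even (count \<nu> j)"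
  shows "even (size \<mu>) = even (size \<nu>)"
proof -
  let ?S = "set_mset \<mu> \<union> set_mset \<nu>"
  have "size \<rho> = (\<Sum>j\<in>?S. count \<rho> j)" if "set_mset \<rho> \<subseteq> ?S" for \<rho>
    unfolding size_multiset_overloaded_eq using that
    by (intro sum.mono_neutral_left) (auto simp: not_in_iff)
  then show ?thesis by (simp add: even_sum_iff assms)
qed

text \<open>\<open>reduce\<close> vanishes only at 0, so the reduced counts have the finite support
  of \<mu>.\<close>

lemma reduced_multiset: "\<exists>\<nu>. \<forall>j. count \<nu> j = reduce q (count \<mu> j)"
proof -
  have "{j. 0 < reduce q (count \<mu> j)} = set_mset \<mu>" by auto
  then show ?thesis
    by (intro exI[of _ "Abs_multiset (\<lambda>j. reduce q (count \<mu> j))"]) (simp add: count_Abs_multiset)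
qed

text \<open>The letter whose exponent may exceed \<open>q - 1\<close> in the even case: \<open>x\<^bsub>j\<^sub>1\<^esub>\<close> if it occurs again, \<open>x\<^bsub>j\<^sub>2\<^esub>\<close>
  otherwise. It is arbitrary if \<open>\<mu>\<close> is empty.\<close>

definition lead :: "nat \<Rightarrow> nat multiset \<Rightarrow> nat" where
  "lead x \<mu> = (if x \<in># \<mu> then x else Min (set_mset \<mu>))"

lemma lead_in: "\<mu> \<noteq> {#} \<Longrightarrow> lead x \<mu> \<in># \<mu>"
  using Min_in[of "set_mset \<mu>"] by (simp add: lead_def)

section \<open>Infinite fields, fields of odd order, fields of even order\<close>

lemma images_form_basis_infinite:
  assumes "\<alpha> \<noteq> (0 :: 'k::field)" "infinite (UNIV :: 'k set)"
  shows "images_form_basis (L9 \<alpha>)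
    ((\<lambda>w. leibniz_ideal +>\<^bsub>free_nonassoc\<^esub> Poly_Mapping.single w 1) ` range canonical_word)"
proof (rule images_form_basis_L9[OF assms(1)])
  fix x :: nat and \<mu> \<nu> :: "nat multiset"
  assume "\<And>c :: nat \<Rightarrow> 'k. (\<Prod>y\<in>#\<mu>. c y) = (\<Prod>y\<in>#\<nu>. c y)"
  then have "\<forall>j (t :: 'k). t ^ count \<mu> j = t ^ count \<nu> j"
    using monomials_eq_iff by blast
  then show "\<mu> = \<nu>"
    using power_eq_on_field(1)[where ?'k = 'k] assms(2) by (intro multiset_eqI) blast
qed auto

text \<open>Reducing every exponent keeps the parity of the size here, so the multisets with all
  exponents below q represent each class once.\<close>

lemma images_form_basis_odd:
  assumes "\<alpha> \<noteq> (0 :: 'k::field)" "finite (UNIV :: 'k set)" "odd CARD('k)"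
  shows "images_form_basis (L9 \<alpha>)
    ((\<lambda>w. leibniz_ideal +>\<^bsub>free_nonassoc\<^esub> Poly_Mapping.single w 1) ` canonical_word ` {(x, \<mu>). \<forall>j. count \<mu> j < CARD('k)})"
proof (rule images_form_basis_L9[OF assms(1)])
  fix x :: nat and \<mu> \<nu> :: "nat multiset"
  assume M: "(x, \<mu>) \<in> {(x, \<mu>). \<forall>j. count \<mu> j < CARD('k)}" "(x, \<nu>) \<in> {(x, \<mu>). \<forall>j. count \<mu> j < CARD('k)}"
    and "\<And>c :: nat \<Rightarrow> 'k. (\<Prod>y\<in>#\<mu>. c y) = (\<Prod>y\<in>#\<nu>. c y)"
  then have "\<forall>j (t :: 'k). t ^ count \<mu> j = t ^ count \<nu> j"
    using monomials_eq_iff by blast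
  then have "reduce CARD('k) (count \<mu> j) = reduce CARD('k) (count \<nu> j)" for j
    by (intro reduce_eq_if_powers_eq assms(2)) blast
  then show "\<mu> = \<nu>"
    using M by (intro multiset_eqI) (simp add: reduce_id)
next
  fix x :: nat and \<mu> :: "nat multiset"
  obtain \<nu> where \<nu>: "\<And>j. count \<nu> j = reduce CARD('k) (count \<mu> j)"
    using reduced_multiset by metis
  have "even (size \<nu>) = even (size \<mu>)"
    using assms(3) by (intro even_size_cong) (simp add: \<nu> reduce_odd)
  moreover have "\<nu> = {#} \<longleftrightarrow> \<mu> = {#}"
    by (simp add: multiset_eq_iff \<nu>)
  moreover have "\<forall>c :: nat \<Rightarrow> 'k. (\<Prod>y\<in>#\<mu>. c y) = (\<Prod>y\<in>#\<nu>. c y)"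
    unfolding monomials_eq_iff by (simp add: \<nu> power_reduce[OF assms(2)])
  ultimately show "\<exists>\<nu>. (x, \<nu>) \<in> {(x, \<mu>). \<forall>j. count \<mu> j < CARD('k)} \<and> even (size \<nu>) = even (size \<mu>) \<and>
      (\<nu> = {#} \<longleftrightarrow> \<mu> = {#}) \<and> (\<forall>c :: nat \<Rightarrow> 'k. (\<Prod>y\<in>#\<mu>. c y) = (\<Prod>y\<in>#\<nu>. c y))"
    using reduce_le[OF card_field_ge_2[OF assms(2)]] by (intro exI[of _ \<nu>]) (simp add: \<nu>)
qed

text \<open>The larger bound leaves room for adding q - 1 once to a reduced exponent of the lead
  letter. This provides the representative of the opposite parity.\<close>

definition even_exponents :: "nat \<Rightarrow> (nat \<times> nat multiset) set" where
  "even_exponents q = {(x, \<mu>). (\<forall>j. j \<noteq> lead x \<mu> \<longrightarrow> count \<mu> j < q) \<and> count \<mu> (lead x \<mu>) < 2 * q - 1}"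

text \<open>Reduction preserves the support, and \<open>lead\<close> depends on \<mu> only through
  it. Thus multisets with the same function share the lead letter and all other exponents, and
  parity settles the exponent of the lead letter. If the reduced multiset has the wrong parity, q -
  1 further copies of the lead letter, an odd number, correct it.\<close>

lemma images_form_basis_even:
  assumes "\<alpha> \<noteq> (0 :: 'k::field)" "finite (UNIV :: 'k set)" "even CARD('k)"
  shows "images_form_basis (L9 \<alpha>)
    ((\<lambda>w. leibniz_ideal +>\<^bsub>free_nonassoc\<^esub> Poly_Mapping.single w 1) ` canonical_word ` even_exponents CARD('k))"
proof (rule images_form_basis_L9[OF assms(1)])
  fix x :: nat and \<mu> \<nu> :: "nat multiset"
  assume M: "(x, \<mu>) \<in> even_exponents CARD('k)" "(x, \<nu>) \<in> even_exponents CARD('k)"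
    and par: "even (size \<mu>) = even (size \<nu>)"
    and "\<And>c :: nat \<Rightarrow> 'k. (\<Prod>y\<in>#\<mu>. c y) = (\<Prod>y\<in>#\<nu>. c y)"
  then have "\<forall>j (t :: 'k). t ^ count \<mu> j = t ^ count \<nu> j"
    using monomials_eq_iff by blast
  then have red: "reduce CARD('k) (count \<mu> j) = reduce CARD('k) (count \<nu> j)" for j
    by (intro reduce_eq_if_powers_eq assms(2)) blast
  have "set_mset \<mu> = set_mset \<nu>"
    using red reduce_eq_0_iff by (metis count_eq_zero_iff subsetI subset_antisym)
  then have l: "lead x \<nu> = lead x \<mu>" by (simp add: lead_def)
  let ?l = "lead x \<mu>"
  have ne: "count \<mu> j = count \<nu> j" if "j \<noteq> ?l" for j
    using that M red[of j] l by (auto simp: even_exponents_def reduce_id)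
  then have "filter_mset (\<lambda>j. j \<noteq> ?l) \<mu> = filter_mset (\<lambda>j. j \<noteq> ?l) \<nu>"
    by (intro multiset_eqI) auto
  moreover have "size \<rho> = count \<rho> ?l + size (filter_mset (\<lambda>j. j \<noteq> ?l) \<rho>)" for \<rho>
    by (induction \<rho>) auto
  ultimately have "even (count \<mu> ?l) = even (count \<nu> ?l)" using par by (metis even_add)
  then have "count \<mu> ?l = count \<nu> ?l"
    using M l by (intro reduce_parity_inj[OF assms(3) red]) (auto simp: even_exponents_def)
  then show "\<mu> = \<nu>" using ne by (metis multiset_eqI)
next
  fix x :: nat and \<mu> :: "nat multiset"
  let ?q = "CARD('k)"
  have q: "2 \<le> ?q" using assms(2) by (rule card_field_ge_2)
  obtain \<nu> where \<nu>: "\<And>j. count \<nu> j = reduce ?q (count \<mu> j)"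
    using reduced_multiset by metis
  have e: "\<nu> = {#} \<longleftrightarrow> \<mu> = {#}"
    by (simp add: multiset_eq_iff \<nu>)
  show "\<exists>\<nu>. (x, \<nu>) \<in> even_exponents ?q \<and> even (size \<nu>) = even (size \<mu>) \<and>
      (\<nu> = {#} \<longleftrightarrow> \<mu> = {#}) \<and> (\<forall>c :: nat \<Rightarrow> 'k. (\<Prod>y\<in>#\<mu>. c y) = (\<Prod>y\<in>#\<nu>. c y))"
  proof (cases "even (size \<nu>) = even (size \<mu>)")
    case True
    have lt: "reduce ?q m < ?q" "reduce ?q m < 2 * ?q - 1" for m
      using reduce_le[OF q, of m] q by linarith+
    have "(x, \<nu>) \<in> even_exponents ?q" using lt by (simp add: even_exponents_def \<nu>)
    then show ?thesis
      using True e unfolding monomials_eq_iff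
      by (intro exI[of _ \<nu>]) (simp add: \<nu> power_reduce[OF assms(2)])
  next
    case False
    \<comment> \<open>The empty multiset is its own reduction, so a change of parity forces some
      letter to occur, and \<open>lead\<close> is then one of the occurring letters.\<close>
    then have ne: "\<mu> \<noteq> {#}" using e by auto
    let ?l = "lead x \<mu>"
    define \<rho> where "\<rho> = \<nu> + replicate_mset (?q - 1) ?l"
    have c: "count \<rho> j = reduce ?q (count \<mu> j) + (if j = ?l then ?q - 1 else 0)" for j
      by (simp add: \<rho>_def \<nu>)
    have pos: "0 < count \<mu> ?l" using lead_in[OF ne] by simp
    have "j \<in># \<rho> \<longleftrightarrow> j \<in># \<mu>" for j
      unfolding count_greater_zero_iff[symmetric] c using pos by (auto simp del: count_greater_zero_iff)
    then have "set_mset \<rho> = set_mset \<mu>" by blast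
    then have l: "lead x \<rho> = ?l" by (simp add: lead_def)
    have "reduce ?q (count \<mu> ?l) + (?q - 1) < 2 * ?q - 1"
      using reduce_le[OF q, of "count \<mu> ?l"] q by linarith
    then have "(x, \<rho>) \<in> even_exponents ?q"
      using reduce_le[OF q] by (auto simp: even_exponents_def l c)
    moreover have "even (size \<rho>) = even (size \<mu>)"
      using False assms(3) q by (auto simp: \<rho>_def)
    moreover have "\<rho> \<noteq> {#}" using q by (auto simp: \<rho>_def)
    moreover have "t ^ count \<mu> j = t ^ count \<rho> j" for j and t :: 'k
    proof (cases "j = ?l")
      case True
      obtain r where r: "reduce ?q (count \<mu> ?l) = Suc r"
        using pos by (metis reduce_pos_iff gr0_implies_Suc)
      have "t ^ count \<rho> j = t ^ (Suc r + (?q - 1) * 1)"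
        by (simp only: c True r simp_thms if_True mult_1_right)
      also have "\<dots> = t ^ Suc r" by (rule power_reduce(1)[OF assms(2)])
      also have "\<dots> = t ^ count \<mu> j"
        unfolding True r[symmetric] by (rule power_reduce(2)[OF assms(2)])
      finally show ?thesis ..
    qed (simp add: c power_reduce[OF assms(2)])
    ultimately show ?thesis
      using ne unfolding monomials_eq_iff by blast
  qed
qed

section \<open>The monomials of the statement\<close>

text \<open>The letters j_2 < ... < j_n attached to the pair of x = j_1 and \<mu>.\<close>

definition other_letters :: "nat \<Rightarrow> nat multiset \<Rightarrow> nat list" where
  "other_letters x \<mu> = sorted_list_of_set (set_mset \<mu> - {x})"

lemma set_other_letters [simp]: "set (other_letters x \<mu>) = set_mset \<mu> - {x}"
  by (simp add: other_letters_def)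

text \<open>Blocks of equal letters, concatenated in increasing order, form the sorted list of the
  letters other than \<open>x\<close>. The \<open>Suc\<close> accounts for the first letter, which
  \<mu> does not count.\<close>

lemma power_monomial_canonical_word:
  "power_monomial (x # other_letters x \<mu>) (Suc (count \<mu> x) # map (count \<mu>) (other_letters x \<mu>)) =
     leibniz_ideal +>\<^bsub>free_nonassoc\<^esub> Poly_Mapping.single (canonical_word (x, \<mu>)) (1 :: 'k::field)"
proof -
  let ?L = "concat (map (\<lambda>j. replicate (count \<mu> j) j) (other_letters x \<mu>))"
  have sorted: "sorted (concat (map (\<lambda>j. replicate (count \<mu> j) j) js))" if "sorted js" for js
    using that by (induction js) (auto simp: sorted_append)
  have count: "count (mset (concat (map (\<lambda>j. replicate (count \<mu> j) j) js))) i =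
      (if i \<in> set js then count \<mu> i else 0)" if "distinct js" for js i
    using that by (induction js) auto
  have "mset ?L = filter_mset (\<lambda>y. y \<noteq> x) \<mu>"
    using count[of "other_letters x \<mu>"] by (intro multiset_eqI) (auto simp: other_letters_def not_in_iff)
  then have "sorted_list_of_multiset (filter_mset (\<lambda>y. y \<noteq> x) \<mu>) = sort ?L"
    by (metis sorted_list_of_multiset_mset)
  also have "\<dots> = ?L"
    using sorted[of "other_letters x \<mu>"] by (intro sort_key_id_if_sorted) (simp_all add: other_letters_def)
  finally have L: "canonical_word (x, \<mu>) = lnword x (replicate (count \<mu> x) x @ ?L)"
    by (simp add: canonical_word_def)
  have z: "map2 (\<lambda>j m. replicate m (gen j :: (magma \<Rightarrow>\<^sub>0 'k) set)) js (map (count \<mu>) js) =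
      map (\<lambda>j. map gen (replicate (count \<mu> j) j)) js" for js
    by (induction js) auto
  have "concat (map2 (\<lambda>j m. replicate m (gen j :: (magma \<Rightarrow>\<^sub>0 'k) set)) (x # other_letters x \<mu>) (Suc (count \<mu> x) # map (count \<mu>) (other_letters x \<mu>))) =
      map gen (x # replicate (count \<mu> x) x @ ?L)"
    by (simp add: z map_concat comp_def)
  then show ?thesis
    unfolding power_monomial_def L by (simp only: left_normed_gens)
qed

text \<open>The multiset \<mu> collects m_1 - 1 copies of x = j_1 and m_i copies of each later j_i.
  Positivity of the exponents makes the later j_i exactly the support of \<mu> away from x.\<close>

lemma L9_index_iff:
  "L9_index js ms \<longleftrightarrow> (\<exists>x \<mu>. js = x # other_letters x \<mu> \<and> ms = Suc (count \<mu> x) # map (count \<mu>) (other_letters x \<mu>))"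
proof
  assume L: "L9_index js ms"
  then obtain x js' where js: "js = x # js'" by (cases js) (auto simp: L9_index_def)
  from L js obtain m ms' where ms: "ms = m # ms'" by (cases ms) (auto simp: L9_index_def)
  from L ms obtain k where k: "m = Suc k" by (cases m) (auto simp: L9_index_def)
  have len: "length js' = length ms'" and pos: "\<forall>m\<in>set ms'. 1 \<le> m" and srt: "sorted_wrt (<) js'" and x: "x \<notin> set js'"
    using L by (auto simp: L9_index_def js ms)
  define \<mu> where "\<mu> = mset (replicate k x @ concat (map2 (\<lambda>j m. replicate m j) js' ms'))"
  have set: "set (concat (map2 (\<lambda>j m. replicate m j) js' ms')) = set js'"
    using len pos by (induction js' ms' rule: list_induct2) auto
  have "distinct js'" using srt by (simp add: strict_sorted_iff)
  with len have map: "map (count (mset (concat (map2 (\<lambda>j m. replicate m j) js' ms')))) js' = ms'"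
  proof (induction js' ms' rule: list_induct2)
    case (Cons a as b bs)
    have "set (concat (map2 (\<lambda>j m. replicate m j) as bs)) \<subseteq> set as"
      using Cons.hyps by (induction as bs rule: list_induct2) auto
    then have "a \<notin> set (concat (map2 (\<lambda>j m. replicate m j) as bs))"
      using Cons.prems by (meson distinct.simps(2) subsetD)
    then have "count (mset (concat (map2 (\<lambda>j m. replicate m j) (a # as) (b # bs)))) a = b"
      by simp
    moreover have "map (count (mset (concat (map2 (\<lambda>j m. replicate m j) (a # as) (b # bs))))) as =
        map (count (mset (concat (map2 (\<lambda>j m. replicate m j) as bs)))) as"
      using Cons.prems by auto
    moreover have "map (count (mset (concat (map2 (\<lambda>j m. replicate m j) as bs)))) as = bs"
      using Cons.IH Cons.prems by simp
    ultimately show ?case by (simp only: list.map)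
  qed simp
  have "set_mset \<mu> - {x} = set js'" using set x by (auto simp: \<mu>_def)
  then have other_letters: "other_letters x \<mu> = js'"
    using srt by (simp add: other_letters_def sorted_list_of_set.idem_if_sorted_distinct strict_sorted_iff)
  have "count \<mu> x = k"
    using set x count_eq_zero_iff[of "mset (concat (map2 (\<lambda>j m. replicate m j) js' ms'))" x] by (simp add: \<mu>_def)
  moreover have "map (count \<mu>) js' = map (count (mset (concat (map2 (\<lambda>j m. replicate m j) js' ms')))) js'"
    using x by (auto simp: \<mu>_def)
  ultimately show "\<exists>x \<mu>. js = x # other_letters x \<mu> \<and> ms = Suc (count \<mu> x) # map (count \<mu>) (other_letters x \<mu>)"
    using other_letters map by (intro exI[of _ x] exI[of _ \<mu>]) (simp add: js ms k)
next
  assume "\<exists>x \<mu>. js = x # other_letters x \<mu> \<and> ms = Suc (count \<mu> x) # map (count \<mu>) (other_letters x \<mu>)"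
  then show "L9_index js ms"
    by (auto simp: L9_index_def other_letters_def Suc_le_eq count_eq_zero_iff)
qed

lemma power_monomials_canonical_words:
  assumes "\<And>x \<mu>. P (Suc (count \<mu> x) # map (count \<mu>) (other_letters x \<mu>)) \<longleftrightarrow> (x, \<mu>) \<in> M"
  shows "{power_monomial js ms | js ms. L9_index js ms \<and> P ms} =
    (\<lambda>w. leibniz_ideal +>\<^bsub>free_nonassoc\<^esub> Poly_Mapping.single w (1 :: 'k::field)) ` canonical_word ` M" (is "?A = ?B")
proof
  show "?A \<subseteq> ?B"
    using assms by (auto simp: L9_index_iff power_monomial_canonical_word)
  show "?B \<subseteq> ?A"
  proof clarify
    fix x \<mu> assume "(x, \<mu>) \<in> M"
    then show "\<exists>js ms. leibniz_ideal +>\<^bsub>free_nonassoc\<^esub> Poly_Mapping.single (canonical_word (x, \<mu>)) 1 = power_monomial js ms \<and>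
        L9_index js ms \<and> P ms"
      using assms L9_index_iff power_monomial_canonical_word[of x \<mu>] by metis
  qed
qed

text \<open>Turns bounds indexed by positions into bounds over a set of exponents, which
  \<open>set_other_letters\<close> can describe.\<close>

lemma all_nth_drop: "(\<forall>i. k \<le> i \<and> i < length xs \<longrightarrow> P (xs ! i)) \<longleftrightarrow> (\<forall>y\<in>set (drop k xs). P y)"
proof
  assume "\<forall>i. k \<le> i \<and> i < length xs \<longrightarrow> P (xs ! i)"
  then show "\<forall>y\<in>set (drop k xs). P y" by (auto simp: in_set_conv_nth)
next
  assume R: "\<forall>y\<in>set (drop k xs). P y"
  show "\<forall>i. k \<le> i \<and> i < length xs \<longrightarrow> P (xs ! i)"
  proof (intro allI impI)
    fix i assume "k \<le> i \<and> i < length xs"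
    then have "xs ! i = drop k xs ! (i - k)" "i - k < length (drop k xs)" by auto
    then show "P (xs ! i)" using R by (metis nth_mem)
  qed
qed

lemma B_L9_eq:
  "B_L9 = (\<lambda>w. leibniz_ideal +>\<^bsub>free_nonassoc\<^esub> Poly_Mapping.single w (1 :: 'k::field)) ` range canonical_word"
  using power_monomials_canonical_words[of "\<lambda>_. True" UNIV] by (simp add: B_L9_def)

text \<open>As m_1 is \<open>Suc (count \<mu> x)\<close>, the bound m_1 \<le> q is the same strict
  bound on \<open>count \<mu> x\<close> as on the other letters; absent letters have count 0 <
  q.\<close>

lemma B_L9_odd_eq:
  assumes "2 \<le> q"
  shows "B_L9_odd q = (\<lambda>w. leibniz_ideal +>\<^bsub>free_nonassoc\<^esub> Poly_Mapping.single w (1 :: 'k::field)) ` canonical_word ` {(x, \<mu>). \<forall>j. count \<mu> j < q}"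
  unfolding B_L9_odd_def all_nth_drop[where P = "\<lambda>m. m < q"]
proof (rule power_monomials_canonical_words[where P = "\<lambda>ms. ms ! 0 \<le> q \<and> (\<forall>m\<in>set (drop 1 ms). m < q)"])
  fix x :: nat and \<mu> :: "nat multiset"
  have z: "count \<mu> j < q" if "j \<notin># \<mu>" for j using that assms by (simp add: not_in_iff)
  show "((Suc (count \<mu> x) # map (count \<mu>) (other_letters x \<mu>)) ! 0 \<le> q \<and>
      (\<forall>m\<in>set (drop 1 (Suc (count \<mu> x) # map (count \<mu>) (other_letters x \<mu>))). m < q)) =
    ((x, \<mu>) \<in> {(x, \<mu>). \<forall>j. count \<mu> j < q})"
    using z by (auto simp: Suc_le_eq)
qed

text \<open>The letter j_2 is the least one different from x. If x occurs again, then m_1 > 1, the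
  lead letter is x and m_2 < q is demanded; otherwise j_2, if present, is the lead letter and has
  the weaker bound. The bound m_1 < 2 * q means \<open>count \<mu> x < 2 * q - 1\<close>.\<close>

lemma B_L9_even_eq:
  assumes "2 \<le> q"
  shows "B_L9_even q = (\<lambda>w. leibniz_ideal +>\<^bsub>free_nonassoc\<^esub> Poly_Mapping.single w (1 :: 'k::field)) ` canonical_word ` even_exponents q"
  unfolding B_L9_even_def all_nth_drop[where P = "\<lambda>m. m < q"]
proof (rule power_monomials_canonical_words[where P = "\<lambda>ms. ms ! 0 < 2 * q \<and>
    (1 < length ms \<longrightarrow> ms ! 1 < 2 * q - 1) \<and> (\<forall>m\<in>set (drop 2 ms). m < q) \<and>
    (1 < length ms \<and> 1 < ms ! 0 \<longrightarrow> ms ! 1 < q)"])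
  fix x :: nat and \<mu> :: "nat multiset"
  have z: "count \<mu> j < q" if "j \<notin># \<mu>" for j using that assms by (simp add: not_in_iff)
  define l where "l = lead x \<mu>"
  let ?P = "\<lambda>ms. ms ! 0 < 2 * q \<and> (1 < length ms \<longrightarrow> ms ! 1 < 2 * q - 1) \<and> (\<forall>m\<in>set (drop 2 ms). m < q) \<and>
      (1 < length ms \<and> 1 < ms ! 0 \<longrightarrow> ms ! 1 < q)"
  have "?P (Suc (count \<mu> x) # map (count \<mu>) (other_letters x \<mu>)) \<longleftrightarrow>
    (\<forall>j. j \<noteq> l \<longrightarrow> count \<mu> j < q) \<and> count \<mu> l < 2 * q - 1"
  proof (cases "set_mset \<mu> - {x} = {}")
    case True
    then have "other_letters x \<mu> = []" by (simp add: other_letters_def)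
    have z': "count \<mu> j < q" if "j \<noteq> x" for j using that True z by blast
    show ?thesis
    proof (cases "x \<in># \<mu>")
      case True
      then show ?thesis using z' assms by (auto simp: l_def lead_def \<open>other_letters x \<mu> = []\<close>)
    next
      case False
      then have "\<mu> = {#}" using True by auto
      then have "count \<mu> j = 0" for j by simp
      then show ?thesis using assms by (simp add: \<open>other_letters x \<mu> = []\<close>)
    qed
  next
    case False
    \<comment> \<open>This is j_2; splitting it off exposes the entry \<open>ms ! 1\<close>.\<close>
    define a where "a = Min (set_mset \<mu> - {x})"
    define R where "R = set_mset \<mu> - {x} - {a}"
    have other_letters: "other_letters x \<mu> = a # sorted_list_of_set R"
      unfolding other_letters_def a_def R_def using False by (intro sorted_list_of_set_nonempty) auto
    have R: "finite R" by (simp add: R_def)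
    have a: "a \<in># \<mu>" "a \<noteq> x" using Min_in[of "set_mset \<mu> - {x}"] False by (auto simp: a_def)
    have rest: "(\<forall>j\<in>R. count \<mu> j < q) \<longleftrightarrow> (\<forall>j. j \<noteq> x \<longrightarrow> j \<noteq> a \<longrightarrow> count \<mu> j < q)"
      using z by (auto simp: R_def)
    have P: "?P (Suc (count \<mu> x) # map (count \<mu>) (other_letters x \<mu>)) \<longleftrightarrow>
        count \<mu> x < 2 * q - 1 \<and> count \<mu> a < 2 * q - 1 \<and> (\<forall>j. j \<noteq> x \<longrightarrow> j \<noteq> a \<longrightarrow> count \<mu> j < q) \<and>
        (x \<in># \<mu> \<longrightarrow> count \<mu> a < q)"
      unfolding rest[symmetric] using assms R by (auto simp: other_letters)
    show ?thesis
    proof (cases "x \<in># \<mu>")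
      case True
      then have "l = x" by (simp add: l_def lead_def)
      then show ?thesis unfolding P using True a(2) assms by auto
    next
      case False
      then have "l = a" by (simp add: l_def lead_def a_def)
      then show ?thesis unfolding P using False a(2) z[OF False] assms by auto
    qed
  qed
  then show "?P (Suc (count \<mu> x) # map (count \<mu>) (other_letters x \<mu>)) = ((x, \<mu>) \<in> even_exponents q)"
    by (simp add: even_exponents_def l_def)
qed

theorem corollary3p11:
  fixes \<alpha> :: "'k::field"
  assumes "\<alpha> \<noteq> 0"
  shows "(infinite (UNIV :: 'k set) \<longrightarrow> images_form_basis (L9 \<alpha>) B_L9) \<and>
    (finite (UNIV :: 'k set) \<and> odd CARD('k) \<longrightarrow> images_form_basis (L9 \<alpha>) (B_L9_odd CARD('k))) \<and>
    (finite (UNIV :: 'k set) \<and> even CARD('k) \<longrightarrow> images_form_basis (L9 \<alpha>) (B_L9_even CARD('k))) \<and>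
    (\<forall>n\<ge>1. codimension (L9 \<alpha>) n = n) \<and>
    convergent (\<lambda>n. root n (real (codimension (L9 \<alpha>) n))) \<and>
    codim_exponent (L9 \<alpha>) = 1"
proof (intro conjI impI)
  show "images_form_basis (L9 \<alpha>) B_L9" if "infinite (UNIV :: 'k set)"
    unfolding B_L9_eq by (rule images_form_basis_infinite[OF assms that])
  show "images_form_basis (L9 \<alpha>) (B_L9_odd CARD('k))" if "finite (UNIV :: 'k set) \<and> odd CARD('k)"
    using that B_L9_odd_eq[OF card_field_ge_2] images_form_basis_odd[OF assms] by metis
  show "images_form_basis (L9 \<alpha>) (B_L9_even CARD('k))" if "finite (UNIV :: 'k set) \<and> even CARD('k)"
    using that B_L9_even_eq[OF card_field_ge_2] images_form_basis_even[OF assms] by metis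
  show "\<forall>n\<ge>1. codimension (L9 \<alpha>) n = n"
    by (simp add: codimension_L9[OF assms])
  have lim: "(\<lambda>n. root n (real (codimension (L9 \<alpha>) n))) \<longlonglongrightarrow> 1"
    unfolding codimension_L9[OF assms] by (rule LIMSEQ_root)
  then show "convergent (\<lambda>n. root n (real (codimension (L9 \<alpha>) n)))" by (rule convergentI)
  show "codim_exponent (L9 \<alpha>) = 1"
    unfolding codim_exponent_def by (rule limI[OF lim])
qed

end
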